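(* Let $\Gamma$ be a countable discrete group and $\Pi$ a dual integrable unitary representation of $\Gamma$ on a separable Hilbert space $\mathcal{H}$, and let $0\neq\psi\in\mathcal{H}$. Then there exists $\phi\in\mathcal{H}$ such that $\{\Pi(\gamma)\phi\}_{\gamma\in\Gamma}$ is a Parseval frame for $\langle\psi\rangle_\Gamma=\overline{\mathrm{span}\{\Pi(\gamma)\psi\}_{\gamma\in\Gamma}}$.
   Context: $\rho$ is the right regular representation on $\ell_2(\Gamma)$, $\rho(\gamma)\delta_{\gamma'}=\delta_{\gamma'\gamma^{-1}}$; $\mathcal{R}(\Gamma)$ is the weak-operator-topology closure of $\mathrm{span}\{\rho(\gamma)\}$ with trace $\tau(F)=\langle F\delta_{\mathrm e},\delta_{\mathrm e}\rangle$; $L^1(\mathcal{R}(\Gamma))$ is the completion of $\mathrm{span}\{\rho(\gamma)\}$ in $\|F\|_1=\tau(|F|)$. $\Pi$ is dual integrable if there is a sesquilinear $[\cdot,\cdot]:\mathcal{H}\times\mathcal{H}\to L^1(\mathcal{R}(\Gamma))$ with $\langle\varphi,\Pi(\gamma)\psi\rangle=\tau([\varphi,\psi]\rho(\gamma))$ for all $\varphi,\psi\in\mathcal{H},\gamma\in\Gamma$. A family $\{f_i\}$ is a Parseval frame for a closed subspace $W$ if $\sum_i|\langle f,f_i\rangle|^2=\|f\|^2$ for all $f\in W$ (with $f_i\in W$). *)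

theory Defs
  imports "HOL-Analysis.Analysis"
begin

definition hnorm :: "('h \<Rightarrow> 'h \<Rightarrow> complex) \<Rightarrow> 'h \<Rightarrow> real" where
  "hnorm ip x = sqrt (Re (ip x x))"

definition complex_hilbert_space ::
  "(complex \<Rightarrow> 'h::ab_group_add \<Rightarrow> 'h) \<Rightarrow> ('h \<Rightarrow> 'h \<Rightarrow> complex) \<Rightarrow> bool" where
  "complex_hilbert_space sc ip \<longleftrightarrow>
     (\<forall>a x y. sc a (x + y) = sc a x + sc a y) \<and>
     (\<forall>a b x. sc (a + b) x = sc a x + sc b x) \<and>
     (\<forall>a b x. sc a (sc b x) = sc (a * b) x) \<and>
     (\<forall>x. sc 1 x = x) \<and>
     (\<forall>x y z. ip (x + y) z = ip x z + ip y z) \<and>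
     (\<forall>a x y. ip (sc a x) y = a * ip x y) \<and>
     (\<forall>x y. ip y x = cnj (ip x y)) \<and>
     (\<forall>x. 0 \<le> Re (ip x x)) \<and>
     (\<forall>x. ip x x = 0 \<longrightarrow> x = 0) \<and>
     (\<forall>X :: nat \<Rightarrow> 'h.
        (\<forall>e>0. \<exists>N. \<forall>m\<ge>N. \<forall>n\<ge>N. hnorm ip (X m - X n) < e) \<longrightarrow>
        (\<exists>L. (\<lambda>n. hnorm ip (X n - L)) \<longlonglongrightarrow> 0))"

definition hclosure :: "('h::ab_group_add \<Rightarrow> 'h \<Rightarrow> complex) \<Rightarrow> 'h set \<Rightarrow> 'h set" where
  "hclosure ip S = {x. \<forall>e>0. \<exists>y\<in>S. hnorm ip (x - y) < e}"

definition hseparable :: "('h::ab_group_add \<Rightarrow> 'h \<Rightarrow> complex) \<Rightarrow> bool" where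
  "hseparable ip \<longleftrightarrow> (\<exists>D. countable D \<and> hclosure ip D = UNIV)"

definition hspan :: "(complex \<Rightarrow> 'h::ab_group_add \<Rightarrow> 'h) \<Rightarrow> 'h set \<Rightarrow> 'h set" where
  "hspan sc S = {x. \<exists>F c. finite F \<and> F \<subseteq> S \<and> x = (\<Sum>v\<in>F. sc (c v) v)}"

section \<open>Unitary representations (group written additively, not assumed abelian)\<close>

definition unitary_rep ::
  "(complex \<Rightarrow> 'h::ab_group_add \<Rightarrow> 'h) \<Rightarrow> ('h \<Rightarrow> 'h \<Rightarrow> complex) \<Rightarrow> ('g::group_add \<Rightarrow> 'h \<Rightarrow> 'h) \<Rightarrow> bool" where
  "unitary_rep sc ip U \<longleftrightarrow>
     (\<forall>g x y. U g (x + y) = U g x + U g y) \<and>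
     (\<forall>g a x. U g (sc a x) = sc a (U g x)) \<and>
     (\<forall>g x y. ip (U g x) (U g y) = ip x y) \<and>
     (\<forall>g. surj (U g)) \<and>
     U 0 = id \<and>
     (\<forall>g h. U (g + h) = U g \<circ> U h)"

definition l2 :: "('g \<Rightarrow> complex) set" where
  "l2 = {f. (\<lambda>x. (cmod (f x))\<^sup>2) summable_on UNIV}"

definition l2_inner :: "('g \<Rightarrow> complex) \<Rightarrow> ('g \<Rightarrow> complex) \<Rightarrow> complex" where
  "l2_inner f h = infsum (\<lambda>x. f x * cnj (h x)) UNIV"

definition l2_norm :: "('g \<Rightarrow> complex) \<Rightarrow> real" where
  "l2_norm f = sqrt (Re (l2_inner f f))"

definition delta :: "'g \<Rightarrow> 'g \<Rightarrow> complex" where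
  "delta g = (\<lambda>x. if x = g then 1 else 0)"

text \<open>rho g is the right regular representation: (rho g f)(x) = f(x g), so that
 rho g (delta g') = delta (g' g^{-1}). Operators are taken to vanish outside l2.\<close>

definition rho :: "'g::group_add \<Rightarrow> ('g \<Rightarrow> complex) \<Rightarrow> ('g \<Rightarrow> complex)" where
  "rho g f = (if f \<in> l2 then (\<lambda>x. f (x + g)) else (\<lambda>_. 0))"

text \<open>The element sum_g a(g) rho(g) of span{rho(g)}, for finitely supported a.\<close>

definition spanop :: "('g::group_add \<Rightarrow> complex) \<Rightarrow> ('g \<Rightarrow> complex) \<Rightarrow> ('g \<Rightarrow> complex)" where
  "spanop a f = (if f \<in> l2 then (\<lambda>x. \<Sum>g\<in>{g. a g \<noteq> 0}. a g * rho g f x) else (\<lambda>_. 0))"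

definition tau :: "(('g::group_add \<Rightarrow> complex) \<Rightarrow> ('g \<Rightarrow> complex)) \<Rightarrow> complex" where
  "tau T = l2_inner (T (delta 0)) (delta 0)"

definition positive_op :: "(('g \<Rightarrow> complex) \<Rightarrow> ('g \<Rightarrow> complex)) \<Rightarrow> bool" where
  "positive_op P \<longleftrightarrow>
     (\<forall>f. f \<notin> l2 \<longrightarrow> P f = (\<lambda>_. 0)) \<and>
     (\<forall>f\<in>l2. P f \<in> l2) \<and>
     (\<forall>f\<in>l2. \<forall>h\<in>l2. P (\<lambda>x. f x + h x) = (\<lambda>x. P f x + P h x)) \<and>
     (\<forall>f\<in>l2. \<forall>c. P (\<lambda>x. c * f x) = (\<lambda>x. c * P f x)) \<and>
     (\<exists>C. \<forall>f\<in>l2. l2_norm (P f) \<le> C * l2_norm f) \<and>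
     (\<forall>f\<in>l2. Im (l2_inner (P f) f) = 0 \<and> 0 \<le> Re (l2_inner (P f) f))"

text \<open>|T| = (T^* T)^{1/2}: the unique positive operator P with P^2 = T^* T.\<close>

definition abs_op :: "(('g \<Rightarrow> complex) \<Rightarrow> ('g \<Rightarrow> complex)) \<Rightarrow> (('g \<Rightarrow> complex) \<Rightarrow> ('g \<Rightarrow> complex))" where
  "abs_op T = (THE P. positive_op P \<and>
       (\<forall>f\<in>l2. \<forall>h\<in>l2. l2_inner (P (P f)) h = l2_inner (T f) (T h)))"

definition finsupp :: "('g \<Rightarrow> complex) \<Rightarrow> bool" where
  "finsupp a \<longleftrightarrow> finite {g. a g \<noteq> 0}"

definition norm1 :: "('g::group_add \<Rightarrow> complex) \<Rightarrow> real" where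
  "norm1 a = Re (tau (abs_op (spanop a)))"

text \<open>Elements of the completion L1(R(Gamma)) are represented by ||.||_1-Cauchy
 sequences in span{rho(g)}; two represent the same element iff their difference
 tends to 0 in ||.||_1.\<close>

definition L1_seq :: "(nat \<Rightarrow> 'g::group_add \<Rightarrow> complex) \<Rightarrow> bool" where
  "L1_seq A \<longleftrightarrow> (\<forall>n. finsupp (A n)) \<and>
     (\<forall>e>0. \<exists>N. \<forall>m\<ge>N. \<forall>n\<ge>N. norm1 (\<lambda>g. A m g - A n g) < e)"

definition L1_eq :: "(nat \<Rightarrow> 'g::group_add \<Rightarrow> complex) \<Rightarrow> (nat \<Rightarrow> 'g \<Rightarrow> complex) \<Rightarrow> bool" where
  "L1_eq A B \<longleftrightarrow> (\<lambda>n. norm1 (\<lambda>g. A n g - B n g)) \<longlonglongrightarrow> 0"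

text \<open>tau(X rho(g)) for X in L1, i.e. the continuous extension: X = lim A n,
 so tau(X rho(g)) = lim tau(A n rho(g)).  We express "tau(X rho(g)) = z" as
 convergence of the approximating traces to z.\<close>

definition L1_tau_rho_eq :: "(nat \<Rightarrow> 'g::group_add \<Rightarrow> complex) \<Rightarrow> 'g \<Rightarrow> complex \<Rightarrow> bool" where
  "L1_tau_rho_eq A g z \<longleftrightarrow> (\<lambda>n. tau (\<lambda>f. spanop (A n) (rho g f))) \<longlonglongrightarrow> z"

definition dual_integrable ::
  "(complex \<Rightarrow> 'h::ab_group_add \<Rightarrow> 'h) \<Rightarrow> ('h \<Rightarrow> 'h \<Rightarrow> complex) \<Rightarrow> ('g::group_add \<Rightarrow> 'h \<Rightarrow> 'h) \<Rightarrow> bool" where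
  "dual_integrable sc ip U \<longleftrightarrow>
     (\<exists>br :: 'h \<Rightarrow> 'h \<Rightarrow> nat \<Rightarrow> 'g \<Rightarrow> complex.
        (\<forall>x y. L1_seq (br x y)) \<and>
        (\<forall>x1 x2 y. L1_eq (br (x1 + x2) y) (\<lambda>n g. br x1 y n g + br x2 y n g)) \<and>
        (\<forall>x y1 y2. L1_eq (br x (y1 + y2)) (\<lambda>n g. br x y1 n g + br x y2 n g)) \<and>
        (\<forall>c x y. L1_eq (br (sc c x) y) (\<lambda>n g. c * br x y n g)) \<and>
        (\<forall>c x y. L1_eq (br x (sc c y)) (\<lambda>n g. cnj c * br x y n g)) \<and>
        (\<forall>x y g. L1_tau_rho_eq (br x y) g (ip x (U g y))))"

definition parseval_frame_for ::
  "('h::ab_group_add \<Rightarrow> 'h \<Rightarrow> complex) \<Rightarrow> ('i \<Rightarrow> 'h) \<Rightarrow> 'h set \<Rightarrow> bool" where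
  "parseval_frame_for ip f W \<longleftrightarrow>
     (\<forall>i. f i \<in> W) \<and>
     (\<forall>x\<in>W. ((\<lambda>i. (cmod (ip x (f i)))\<^sup>2) has_sum (hnorm ip x)\<^sup>2) UNIV)"

end

theory Submission
  imports Defs
begin

text \<open>Write \<open>A\<^sub>n\<close> for finitely supported functions approximating the bracket of \<open>psi\<close> with itself.
  Along a subsequence the differences \<open>a\<close> of consecutive terms have summable trace norms, and the polar
  decomposition of the associated operator turns each into a coefficient \<open>a g = ip (\<lambda> g c) d\<close> of the left
  regular representation \<open>\<lambda>\<close>, with squared norms of \<open>c\<close>, \<open>d\<close> at most the trace norm. Summing up,
  \<open>ip (U g psi) psi\<close> is a coefficient of a countable multiple of \<open>\<lambda>\<close>. Hence some multiple of
  \<open>\<lambda>\<close> maps onto a dense subspace of the cyclic space of \<open>psi\<close>, and the images of the unit vectors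
  show that the analysis map \<open>C: v \<mapsto> (ip v (U g psi))\<^sub>g\<close> is a densely defined closed operator into
  \<open>l2\<close>. The isometric part of its polar decomposition intertwines \<open>U\<close> on the cyclic space with
  \<open>\<lambda>\<close>, so its adjoint sends the unit vector at the identity to a Parseval generator.\<close>

section \<open>Hilbert spaces over an explicit scalar multiplication and inner product\<close>

text \<open>The bracket lives in an abstract completion, and no operator is attached to its limit.
  Only matrix coefficients are carried through the limit; the factor vectors of each difference have
  squared norms bounded by its trace norm, and this is what makes their infinite direct sum a
  vector. The trace norm is reached through \<open>abs_op\<close>, a definite description, so
  nothing can be said about \<open>norm1\<close> before existence and uniqueness of positive square
  roots. The root is produced by an iteration instead of spectral theory; its limit commutes with
  everything that commutes with the given operator, and in this way translation invariance passes to
  roots and polar parts. The cyclic space is not a type. Operators act on the whole space, and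
  membership in the cyclic space is expressed by orthogonality to whatever is orthogonal to the
  orbit. Polar decomposition is set up for bounded operators only, while the coefficients of
  \<open>psi\<close> itself need not be square summable; hence the density argument and the passage
  to a bounded operator.\<close>

locale chilbert =
  fixes sc :: "complex \<Rightarrow> 'h::ab_group_add \<Rightarrow> 'h"
    and ip :: "'h \<Rightarrow> 'h \<Rightarrow> complex"
  assumes hilbert: "complex_hilbert_space sc ip"
begin

abbreviation nrm :: "'h \<Rightarrow> real" where "nrm \<equiv> hnorm ip"

lemmas sc_axioms = hilbert[unfolded complex_hilbert_space_def]
lemmas ip_axioms = sc_axioms[THEN conjunct2, THEN conjunct2, THEN conjunct2, THEN conjunct2]
lemmas sc_add_right = sc_axioms[THEN conjunct1, rule_format]
  and sc_add_left = sc_axioms[THEN conjunct2, THEN conjunct1, rule_format]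
  and sc_sc [simp] = sc_axioms[THEN conjunct2, THEN conjunct2, THEN conjunct1, rule_format]
  and sc_one [simp] =
    sc_axioms[THEN conjunct2, THEN conjunct2, THEN conjunct2, THEN conjunct1, rule_format]
  and ip_add_left = ip_axioms[THEN conjunct1, rule_format]
  and ip_sc_left [simp] = ip_axioms[THEN conjunct2, THEN conjunct1, rule_format]
  and ip_commute = ip_axioms[THEN conjunct2, THEN conjunct2, THEN conjunct1, rule_format]
lemmas ip_definite_axioms = ip_axioms[THEN conjunct2, THEN conjunct2, THEN conjunct2]
lemmas ip_ge_zero = ip_definite_axioms[THEN conjunct1, rule_format]
  and ip_self_zero = ip_definite_axioms[THEN conjunct2, THEN conjunct1, rule_format]

lemma complete:
  assumes "\<And>e. e > 0 \<Longrightarrow> \<exists>N. \<forall>m\<ge>N. \<forall>n\<ge>N. nrm (X m - X n) < e"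
  shows "\<exists>L. (\<lambda>n. nrm (X n - L)) \<longlonglongrightarrow> 0"
  using ip_definite_axioms[THEN conjunct2, THEN conjunct2] assms by blast

lemma sc_zero_left [simp]: "sc 0 x = 0"
  using sc_add_left[of 0 0 x] by simp

lemma sc_zero_right [simp]: "sc a 0 = 0"
  using sc_add_right[of a 0 0] by simp

lemma sc_minus_left: "sc (- a) x = - sc a x"
  using sc_add_left[of a "- a" x] by (simp add: minus_unique)

lemma sc_minus_right: "sc a (- x) = - sc a x"
  using sc_add_right[of a x "- x"] by (simp add: minus_unique)

lemma sc_diff_right: "sc a (x - y) = sc a x - sc a y"
  using sc_add_right[of a x "- y"] by (simp add: sc_minus_right)

lemma ip_add_right: "ip x (y + z) = ip x y + ip x z"
  by (metis ip_commute ip_add_left complex_cnj_add)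

lemma ip_sc_right [simp]: "ip x (sc a y) = cnj a * ip x y"
  by (metis ip_commute ip_sc_left complex_cnj_mult)

lemma ip_zero_left [simp]: "ip 0 x = 0"
  using ip_add_left[of 0 0 x] by simp

lemma ip_zero_right [simp]: "ip x 0 = 0"
  using ip_add_right[of x 0 0] by simp

lemma ip_minus_left [simp]: "ip (- x) y = - ip x y"
  using ip_add_left[of x "- x" y] by (simp add: minus_unique)

lemma ip_minus_right [simp]: "ip y (- x) = - ip y x"
  using ip_add_right[of y x "- x"] by (simp add: minus_unique)

lemma ip_diff_left: "ip (x - y) z = ip x z - ip y z"
  using ip_add_left[of x "- y" z] by simp

lemma ip_diff_right: "ip z (x - y) = ip z x - ip z y"
  using ip_add_right[of z x "- y"] by simp

lemma ip_sum_left: "ip (sum f A) z = (\<Sum>a\<in>A. ip (f a) z)"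
  by (induction A rule: infinite_finite_induct) (auto simp: ip_add_left)

lemma ip_sum_right: "ip z (sum f A) = (\<Sum>a\<in>A. ip z (f a))"
  by (induction A rule: infinite_finite_induct) (auto simp: ip_add_right)

lemma sc_sum_right: "sc c (sum f A) = (\<Sum>a\<in>A. sc c (f a))"
  by (induction A rule: infinite_finite_induct) (auto simp: sc_add_right)

lemma Im_ip_self [simp]: "Im (ip x x) = 0"
  using arg_cong[OF ip_commute[of x x], of Im] by simp

lemma nrm_ge_zero [simp]: "0 \<le> nrm x"
  by (simp add: hnorm_def ip_ge_zero)

lemma nrm_power2: "(nrm x)\<^sup>2 = Re (ip x x)"
  by (simp add: hnorm_def ip_ge_zero)

lemma ip_self: "ip x x = complex_of_real ((nrm x)\<^sup>2)"
  by (simp add: nrm_power2 complex_eq_iff)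

lemma nrm_zero_iff [simp]: "nrm x = 0 \<longleftrightarrow> x = 0"
  by (metis hnorm_def ip_self ip_self_zero ip_zero_left of_real_0 power_zero_numeral
      real_sqrt_zero zero_complex.simps(1))

lemma nrm_zero [simp]: "nrm 0 = 0"
  by simp

lemma ip_nondegenerate: "(\<And>y. ip y x = 0) \<Longrightarrow> x = 0"
  by (simp add: ip_self_zero)

lemma ip_eqI: "(\<And>z. ip z x = ip z y) \<Longrightarrow> x = y"
  using ip_nondegenerate[of "x - y"] by (simp add: ip_diff_right)

lemma ip_eqI': "(\<And>z. ip x z = ip y z) \<Longrightarrow> x = y"
  by (metis ip_commute ip_eqI)

lemma nrm_sc [simp]: "nrm (sc a x) = cmod a * nrm x"
proof -
  have *: "ip (sc a x) (sc a x) = of_real ((cmod a)\<^sup>2) * ip x x"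
    by (simp add: complex_norm_square ac_simps del: of_real_power)
  have "(nrm (sc a x))\<^sup>2 = (cmod a * nrm x)\<^sup>2"
    unfolding nrm_power2 power_mult_distrib * by (simp del: of_real_power)
  then show ?thesis by (simp add: power2_eq_iff_nonneg)
qed

lemma nrm_minus [simp]: "nrm (- x) = nrm x"
  by (simp add: hnorm_def)

lemma nrm_minus_commute: "nrm (x - y) = nrm (y - x)"
  by (metis minus_diff_eq nrm_minus)

lemma nrm_add_power2: "(nrm (x + y))\<^sup>2 = (nrm x)\<^sup>2 + (nrm y)\<^sup>2 + 2 * Re (ip x y)"
  unfolding nrm_power2 ip_add_left ip_add_right ip_commute[of x y] by simp

lemma nrm_diff_power2: "(nrm (x - y))\<^sup>2 = (nrm x)\<^sup>2 + (nrm y)\<^sup>2 - 2 * Re (ip x y)"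
  using nrm_add_power2[of x "- y"] by simp

lemma cauchy_schwarz: "cmod (ip x y) \<le> nrm x * nrm y"
proof (cases "y = 0")
  case False
  define a where "a = ip x y / complex_of_real ((nrm y)\<^sup>2)"
  have y: "nrm y > 0" using False nrm_ge_zero[of y] nrm_zero_iff[of y] by linarith
  have "0 \<le> (nrm (x - sc a y))\<^sup>2" by simp
  also have "\<dots> = (nrm x)\<^sup>2 + (cmod a * nrm y)\<^sup>2 - 2 * Re (cnj a * ip x y)"
    by (simp add: nrm_diff_power2)
  also have "Re (cnj a * ip x y) = (cmod (ip x y))\<^sup>2 / (nrm y)\<^sup>2"
    by (simp add: a_def cmod_power2) (simp add: power2_eq_square add_divide_distrib)
  also have "(cmod a * nrm y)\<^sup>2 = (cmod (ip x y))\<^sup>2 / (nrm y)\<^sup>2"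
    using y by (simp add: a_def norm_divide norm_power power_mult_distrib power_divide)
      (simp add: power2_eq_square power4_eq_xxxx)
  finally have "(cmod (ip x y))\<^sup>2 \<le> (nrm x * nrm y)\<^sup>2"
    using False by (simp add: pos_divide_le_eq power_mult_distrib)
  then show ?thesis by (rule power2_le_imp_le) simp
qed simp

lemma nrm_triangle: "nrm (x + y) \<le> nrm x + nrm y"
proof (rule power2_le_imp_le)
  have "Re (ip x y) \<le> nrm x * nrm y"
    using cauchy_schwarz[of x y] complex_Re_le_cmod order_trans by blast
  then show "(nrm (x + y))\<^sup>2 \<le> (nrm x + nrm y)\<^sup>2"
    by (simp add: nrm_add_power2 power2_sum)
qed simp

lemma nrm_triangle_diff: "nrm (x - z) \<le> nrm (x - y) + nrm (y - z)"
  using nrm_triangle[of "x - y" "y - z"] by simp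

lemma parallelogram: "(nrm (x + y))\<^sup>2 + (nrm (x - y))\<^sup>2 = 2 * (nrm x)\<^sup>2 + 2 * (nrm y)\<^sup>2"
  by (simp add: nrm_add_power2 nrm_diff_power2)

section \<open>Norm convergence and closures\<close>

abbreviation tends :: "(nat \<Rightarrow> 'h) \<Rightarrow> 'h \<Rightarrow> bool" where
  "tends X L \<equiv> (\<lambda>n. nrm (X n - L)) \<longlonglongrightarrow> 0"

lemma tendsI:
  assumes "\<And>n. nrm (X n - L) \<le> b n" "b \<longlonglongrightarrow> 0"
  shows "tends X L"
  by (rule tendsto_sandwich[OF _ _ tendsto_const assms(2)]) (simp_all add: assms(1))

lemma tends_ip_left: "tends X L \<Longrightarrow> (\<lambda>n. ip (X n) y) \<longlonglongrightarrow> ip L y"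
proof -
  assume t: "tends X L"
  have "(\<lambda>n. cmod (ip (X n) y - ip L y)) \<longlonglongrightarrow> 0"
    by (rule tendsto_sandwich[OF _ _ tendsto_const tendsto_mult_left_zero[OF t, of "nrm y"]])
      (simp_all add: cauchy_schwarz flip: ip_diff_left)
  then show ?thesis
    using Lim_null tendsto_norm_zero_iff by blast
qed

lemma tends_ip_right: "tends X L \<Longrightarrow> (\<lambda>n. ip y (X n)) \<longlonglongrightarrow> ip y L"
  using tendsto_cnj[OF tends_ip_left] ip_commute[of y] by simp

lemma tends_const: "tends (\<lambda>_. x) x"
  by simp

lemma tends_add: "tends X L \<Longrightarrow> tends Y M \<Longrightarrow> tends (\<lambda>n. X n + Y n) (L + M)"
proof -
  assume "tends X L" "tends Y M"
  then have "(\<lambda>n. nrm (X n - L) + nrm (Y n - M)) \<longlonglongrightarrow> 0"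
    using tendsto_add_zero by blast
  then show ?thesis
    by (rule tendsI[rotated]) (metis add_diff_add nrm_triangle)
qed

lemma tends_sc: "tends X L \<Longrightarrow> tends (\<lambda>n. sc a (X n)) (sc a L)"
  using tendsto_mult_right_zero[of "\<lambda>n. nrm (X n - L)" sequentially "cmod a"]
  by (simp flip: sc_diff_right)

lemma tends_unique: "tends X L \<Longrightarrow> tends X M \<Longrightarrow> L = M"
  by (rule ip_eqI') (rule LIMSEQ_unique, (erule tends_ip_left)+)

lemma tends_nrm: "tends X L \<Longrightarrow> (\<lambda>n. nrm (X n)) \<longlonglongrightarrow> nrm L"
proof -
  assume t: "tends X L"
  have *: "\<bar>nrm (X n) - nrm L\<bar> \<le> nrm (X n - L)" for n
    using nrm_triangle[of "X n - L" L] nrm_triangle[of "L - X n" "X n"] nrm_minus_commute[of L "X n"]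
    by (simp add: abs_le_iff)
  have "(\<lambda>n. \<bar>nrm (X n) - nrm L\<bar>) \<longlonglongrightarrow> 0"
    by (rule tendsto_sandwich[OF _ _ tendsto_const t]) (simp_all add: *)
  then show ?thesis using LIM_zero_cancel tendsto_rabs_zero_iff by blast
qed

lemma mem_hclosure_seq:
  assumes "x \<in> hclosure ip S"
  obtains s where "\<And>n. s n \<in> S" "tends s x"
proof -
  have "\<exists>y\<in>S. nrm (x - y) < 1 / Suc n" for n
    using assms unfolding hclosure_def by simp
  then obtain s where s: "\<And>n. s n \<in> S" "\<And>n. nrm (x - s n) < 1 / Suc n"
    by metis
  have "tends s x"
    by (rule tendsI[OF _ lim_inverse_n'[THEN LIMSEQ_Suc]])
      (metis s(2) less_imp_le nrm_minus_commute)
  with s that show ?thesis by blast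
qed

lemma seq_mem_hclosure:
  assumes "\<And>n. s n \<in> S" "tends s x"
  shows "x \<in> hclosure ip S"
  unfolding hclosure_def
proof (intro CollectI allI impI)
  fix e :: real assume "e > 0"
  then obtain n where "nrm (s n - x) < e"
    using LIMSEQ_D[OF assms(2), of e] by auto
  then show "\<exists>y\<in>S. nrm (x - y) < e"
    using assms(1) nrm_minus_commute by metis
qed

lemma hclosure_superset: "S \<subseteq> hclosure ip S"
  unfolding hclosure_def by force

lemma hclosure_orthogonal:
  assumes "x \<in> hclosure ip S" "\<And>s. s \<in> S \<Longrightarrow> ip s v = 0"
  shows "ip x v = 0"
proof -
  obtain s where s: "\<And>n. s n \<in> S" "tends s x" using mem_hclosure_seq[OF assms(1)] by blast
  have "(\<lambda>n. ip (s n) v) \<longlonglongrightarrow> ip x v" by (rule tends_ip_left[OF s(2)])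
  then show ?thesis using assms(2)[OF s(1)] by (simp add: LIMSEQ_const_iff)
qed

text \<open>The difference is orthogonal to \<open>S\<close>, hence to the limits \<open>x\<close>
  and \<open>y\<close>, hence to itself.\<close>

lemma hclosure_unique:
  assumes "x \<in> hclosure ip S" "y \<in> hclosure ip S" "\<And>s. s \<in> S \<Longrightarrow> ip s x = ip s y"
  shows "x = y"
proof -
  have "ip s (x - y) = 0" if "s \<in> S" for s
    using assms(3)[OF that] by (simp add: ip_diff_right)
  then have "ip x (x - y) = 0" "ip y (x - y) = 0"
    using hclosure_orthogonal assms(1,2) by blast+
  then have "ip (x - y) (x - y) = 0" by (simp add: ip_diff_left)
  then show ?thesis using ip_self_zero by fastforce
qed

section \<open>Subspaces, representation of functionals and orthogonal projection\<close>

definition subsp :: "'h set \<Rightarrow> bool" where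
  "subsp S \<longleftrightarrow> 0 \<in> S \<and> (\<forall>x\<in>S. \<forall>y\<in>S. x + y \<in> S) \<and> (\<forall>a. \<forall>x\<in>S. sc a x \<in> S)"

lemma subsp_hclosure:
  assumes S: "subsp S"
  shows "subsp (hclosure ip S)"
  unfolding subsp_def
proof (intro conjI ballI allI)
  show "0 \<in> hclosure ip S" using hclosure_superset S unfolding subsp_def by blast
  fix x assume "x \<in> hclosure ip S"
  then obtain s where s: "\<And>n. s n \<in> S" "tends s x" using mem_hclosure_seq by blast
  show "sc a x \<in> hclosure ip S" for a
    using S s(1) by (intro seq_mem_hclosure[OF _ tends_sc[OF s(2)]]) (auto simp: subsp_def)
  fix y assume "y \<in> hclosure ip S"
  then obtain t where t: "\<And>n. t n \<in> S" "tends t y" using mem_hclosure_seq by blast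
  show "x + y \<in> hclosure ip S"
    using S s(1) t(1) by (intro seq_mem_hclosure[OF _ tends_add[OF s(2) t(2)]]) (auto simp: subsp_def)
qed

text \<open>The representing vector is found by minimising \<open>\<parallel>s\<parallel>\<^sup>2 - 2 Re (f s)\<close> over the subspace, which
  needs neither completeness of the subspace nor a prior projection theorem.\<close>

lemma riesz_subspace:
  assumes S: "subsp S"
    and fadd: "\<And>x y. x \<in> S \<Longrightarrow> y \<in> S \<Longrightarrow> f (x + y) = f x + f y"
    and fsc: "\<And>a x. x \<in> S \<Longrightarrow> f (sc a x) = a * f x"
    and bnd: "\<And>x. x \<in> S \<Longrightarrow> cmod (f x) \<le> c * nrm x"
  shows "\<exists>w\<in>hclosure ip S. \<forall>s\<in>S. f s = ip s w"
proof -
  have S0: "0 \<in> S" and Sadd: "\<And>x y. x \<in> S \<Longrightarrow> y \<in> S \<Longrightarrow> x + y \<in> S"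
    and Ssc: "\<And>a x. x \<in> S \<Longrightarrow> sc a x \<in> S"
    using S unfolding subsp_def by blast+
  define J where "J s = (nrm s)\<^sup>2 - 2 * Re (f s)" for s
  have lower: "- (c\<^sup>2) \<le> J s" if "s \<in> S" for s
  proof -
    have "Re (f s) \<le> c * nrm s"
      using bnd[OF that] complex_Re_le_cmod order_trans by blast
    moreover have "0 \<le> (nrm s - c)\<^sup>2" by simp
    ultimately show ?thesis unfolding J_def power2_diff by (simp add: mult.commute)
  qed
  define d where "d = Inf (J ` S)"
  have bdd: "bdd_below (J ` S)" using lower by (auto intro!: bdd_belowI2)
  have dle: "d \<le> J s" if "s \<in> S" for s
    unfolding d_def using bdd that by (simp add: cInf_lower)
  have "\<exists>s\<in>S. J s < d + 1 / Suc n" for n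
  proof (rule ccontr)
    assume "\<not> ?thesis"
    then have "d + 1 / Suc n \<le> d"
      unfolding d_def[symmetric] using S0
      by (subst (2) d_def, intro cInf_greatest) (auto simp: not_less)
    then show False by simp
  qed
  then obtain s where s: "\<And>n. s n \<in> S" "\<And>n. J (s n) < d + 1 / Suc n" by metis
  have diff: "(nrm (s m - s n))\<^sup>2 \<le> 2 * (1 / Suc m) + 2 * (1 / Suc n)" for m n
  proof -
    \<comment> \<open>In the combination of \<open>J\<close> at two points and at their midpoint the
      linear terms cancel, so the parallelogram law controls the distance of two
      near-minimisers.\<close>
    let ?h = "sc (1/2) (s m + s n)"
    have h1: "(nrm ?h)\<^sup>2 = (nrm (s m + s n))\<^sup>2 / 4" by (simp add: power_mult_distrib power_divide)
    have h2: "f ?h = (f (s m) + f (s n)) / 2"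
      by (simp add: s Sadd fsc fadd)
    have "4 * J ?h = (nrm (s m + s n))\<^sup>2 - 4 * Re (f (s m)) - 4 * Re (f (s n))"
      unfolding J_def h1 h2 by (simp add: field_simps)
    then have "(nrm (s m - s n))\<^sup>2 = 2 * J (s m) + 2 * J (s n) - 4 * J ?h"
      using parallelogram[of "s m" "s n"] by (simp add: J_def)
    moreover have "d \<le> J ?h" by (intro dle Ssc Sadd s)
    ultimately show ?thesis using s(2)[of m] s(2)[of n] by linarith
  qed
  have "\<exists>w. tends s w"
  proof (rule complete)
    fix e :: real assume e: "e > 0"
    then obtain N where N: "1 / Suc N < e\<^sup>2 / 4"
      using nat_approx_posE[of "e\<^sup>2 / 4"] by auto
    have "nrm (s m - s n) < e" if "m \<ge> N" "n \<ge> N" for m n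
    proof -
      have "1 / Suc m \<le> 1 / Suc N" "1 / Suc n \<le> 1 / Suc N"
        using that by (simp_all add: frac_le)
      then have "(nrm (s m - s n))\<^sup>2 < e\<^sup>2" using diff[of m n] N by linarith
      then show ?thesis using e power2_less_imp_less by fastforce
    qed
    then show "\<exists>N. \<forall>m\<ge>N. \<forall>n\<ge>N. nrm (s m - s n) < e" by blast
  qed
  then obtain w where w: "tends s w" by blast
  \<comment> \<open>The limit \<open>w\<close> is in the closure only, where \<open>f\<close> and
    \<open>J\<close> say nothing. The variational inequality is therefore derived at the points
    \<open>s n\<close> and passed to the limit.\<close>
  have var: "0 \<le> (nrm t)\<^sup>2 + 2 * Re (ip t w - f t)" if t: "t \<in> S" for t
  proof -
    have "- (1 / Suc n) \<le> (nrm t)\<^sup>2 + 2 * Re (ip t (s n) - f t)" for n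
    proof -
      have "d \<le> J (t + s n)" by (intro dle Sadd t s)
      also have "\<dots> = J (s n) + ((nrm t)\<^sup>2 + 2 * Re (ip t (s n) - f t))"
        using t s(1) by (simp add: J_def nrm_add_power2 fadd)
      finally show ?thesis using s(2)[of n] by simp
    qed
    moreover have "(\<lambda>n. (nrm t)\<^sup>2 + 2 * Re (ip t (s n) - f t)) \<longlonglongrightarrow> (nrm t)\<^sup>2 + 2 * Re (ip t w - f t)"
      by (intro tendsto_intros tends_ip_right w)
    moreover have "(\<lambda>n. - (1 / real (Suc n))) \<longlonglongrightarrow> 0"
      using tendsto_minus[OF lim_inverse_n'[THEN LIMSEQ_Suc]] by simp
    ultimately show ?thesis by (meson LIMSEQ_le)
  qed
  have "f t = ip t w" if t: "t \<in> S" for t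
  proof (rule ccontr)
    define z where "z = ip t w - f t"
    assume "f t \<noteq> ip t w"
    then have z: "cmod z > 0" by (simp add: z_def)
    \<comment> \<open>The test vector is \<open>t\<close> scaled by \<open>- e * cnj z\<close>. With
      this \<open>e\<close> the quadratic term stays below the linear one, and the total is strictly
      negative.\<close>
    define e where "e = 1 / (1 + (nrm t)\<^sup>2)"
    have e: "e > 0" "e * (nrm t)\<^sup>2 < 1" by (simp_all add: e_def divide_simps add_pos_nonneg)
    have k: "ip (sc a t) w - f (sc a t) = a * z" for a
      by (simp add: fsc t z_def right_diff_distrib)
    have nk: "(nrm (sc (- e * cnj z) t))\<^sup>2 = e\<^sup>2 * (cmod z)\<^sup>2 * (nrm t)\<^sup>2"
      using e by (simp add: norm_mult power_mult_distrib)
    have "0 \<le> (nrm (sc (- e * cnj z) t))\<^sup>2 + 2 * Re (ip (sc (- e * cnj z) t) w - f (sc (- e * cnj z) t))"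
      by (intro var Ssc t)
    also have "\<dots> = e\<^sup>2 * (cmod z)\<^sup>2 * (nrm t)\<^sup>2 + 2 * Re (- e * cnj z * z)"
      unfolding nk k ..
    also have "- e * cnj z * z = complex_of_real (- e * (cmod z)\<^sup>2)"
      by (simp add: complex_norm_square mult.commute del: of_real_power)
    also have "e\<^sup>2 * (cmod z)\<^sup>2 * (nrm t)\<^sup>2 + 2 * Re (complex_of_real (- e * (cmod z)\<^sup>2))
        = e * (cmod z)\<^sup>2 * (e * (nrm t)\<^sup>2 - 2)"
      by (simp add: algebra_simps power2_eq_square)
    also have "\<dots> < 0"
      using e z by (intro mult_pos_neg) auto
    finally show False by simp
  qed
  moreover have "w \<in> hclosure ip S" using seq_mem_hclosure[OF s(1) w] .
  ultimately show ?thesis by blast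
qed

lemma ex_projection:
  assumes "subsp S"
  shows "\<exists>w\<in>hclosure ip S. \<forall>s\<in>S. ip s x = ip s w"
  by (rule riesz_subspace[OF assms, of "\<lambda>s. ip s x" "nrm x"])
    (auto simp: ip_add_left cauchy_schwarz mult.commute[of "nrm x"])

text \<open>With \<open>w\<close> the projection of \<open>x\<close>, the vector
  \<open>x - w\<close> is orthogonal to \<open>S\<close>, hence to \<open>x\<close> by hypothesis
  and to \<open>w\<close> as a limit of elements of \<open>S\<close>. This is the only test for
  membership in a closure that later arguments need when no approximating sequence is at
  hand.\<close>

lemma orthogonal_complement_complement:
  assumes S: "subsp S" and x: "\<And>v. (\<And>s. s \<in> S \<Longrightarrow> ip s v = 0) \<Longrightarrow> ip x v = 0"
  shows "x \<in> hclosure ip S"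
proof -
  obtain w where w: "w \<in> hclosure ip S" "\<And>s. s \<in> S \<Longrightarrow> ip s x = ip s w"
    using ex_projection[OF S] by blast
  have o: "ip s (x - w) = 0" if "s \<in> S" for s using w(2)[OF that] by (simp add: ip_diff_right)
  have "ip (x - w) (x - w) = 0"
    using x[of "x - w", OF o] hclosure_orthogonal[OF w(1), of "x - w"] o by (simp add: ip_diff_left)
  then show ?thesis using ip_self_zero w(1) by fastforce
qed

end

section \<open>Bounded operators and adjoints\<close>

definition bop ::
  "(complex \<Rightarrow> 'a::ab_group_add \<Rightarrow> 'a) \<Rightarrow> ('a \<Rightarrow> 'a \<Rightarrow> complex) \<Rightarrow>
   (complex \<Rightarrow> 'b::ab_group_add \<Rightarrow> 'b) \<Rightarrow> ('b \<Rightarrow> 'b \<Rightarrow> complex) \<Rightarrow> real \<Rightarrow> ('a \<Rightarrow> 'b) \<Rightarrow> bool" where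
  "bop sc ip sc' ip' C T \<longleftrightarrow> 0 \<le> C \<and> (\<forall>x y. T (x + y) = T x + T y) \<and>
     (\<forall>a x. T (sc a x) = sc' a (T x)) \<and> (\<forall>x. hnorm ip' (T x) \<le> C * hnorm ip x)"

lemma bopI:
  assumes "0 \<le> C" "\<And>x y. T (x + y) = T x + T y" "\<And>a x. T (sc a x) = sc' a (T x)"
    "\<And>x. hnorm ip' (T x) \<le> C * hnorm ip x"
  shows "bop sc ip sc' ip' C T"
  using assms unfolding bop_def by blast

lemma
  assumes "bop sc ip sc' ip' C T"
  shows bop_nonneg: "0 \<le> C" and bop_add: "T (x + y) = T x + T y"
    and bop_sc: "T (sc a x) = sc' a (T x)" and bop_bound: "hnorm ip' (T x) \<le> C * hnorm ip x"
  using assms by (simp_all add: bop_def)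

lemma
  assumes T: "bop sc ip sc' ip' C T"
  shows bop_zero: "T 0 = 0" and bop_minus: "T (- x) = - T x" and bop_diff: "T (x - y) = T x - T y"
    and bop_sum: "T (sum f A) = (\<Sum>a\<in>A. T (f a))"
proof -
  show 0: "T 0 = 0" using bop_add[OF T, of 0 0] by simp
  show m: "T (- x) = - T x" for x
    using bop_add[OF T, of x "- x"] by (simp add: 0 minus_unique)
  show "T (x - y) = T x - T y" using bop_add[OF T, of x "- y"] by (simp add: m)
  show "T (sum f A) = (\<Sum>a\<in>A. T (f a))"
    by (induction A rule: infinite_finite_induct) (simp_all add: 0 bop_add[OF T])
qed

lemma bop_compose:
  assumes "bop sc1 ip1 sc2 ip2 C S" "bop sc2 ip2 sc3 ip3 D T"
  shows "bop sc1 ip1 sc3 ip3 (D * C) (\<lambda>x. T (S x))"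
proof (rule bopI)
  fix x
  have "hnorm ip3 (T (S x)) \<le> D * hnorm ip2 (S x)" by (rule bop_bound[OF assms(2)])
  also have "\<dots> \<le> D * (C * hnorm ip1 x)"
    by (intro mult_left_mono bop_bound[OF assms(1)] bop_nonneg[OF assms(2)])
  finally show "hnorm ip3 (T (S x)) \<le> D * C * hnorm ip1 x" by (simp add: mult.assoc)
qed (simp_all add: assms[THEN bop_nonneg] assms[THEN bop_add] assms[THEN bop_sc])

locale chilbert_pair = A: chilbert sc ip + B: chilbert sc' ip'
  for sc :: "complex \<Rightarrow> 'a::ab_group_add \<Rightarrow> 'a" and ip :: "'a \<Rightarrow> 'a \<Rightarrow> complex"
    and sc' :: "complex \<Rightarrow> 'b::ab_group_add \<Rightarrow> 'b" and ip' :: "'b \<Rightarrow> 'b \<Rightarrow> complex"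
begin

lemma bop_tends:
  assumes T: "bop sc ip sc' ip' C T" and X: "A.tends X L"
  shows "B.tends (\<lambda>n. T (X n)) (T L)"
proof (rule B.tendsI)
  show "B.nrm (T (X n) - T L) \<le> C * A.nrm (X n - L)" for n
    using bop_bound[OF T, of "X n - L"] by (simp add: bop_diff[OF T])
  show "(\<lambda>n. C * A.nrm (X n - L)) \<longlonglongrightarrow> 0" by (rule tendsto_mult_right_zero[OF X])
qed

text \<open>When \<open>q\<close> is dominated by \<open>p\<close> for all \<open>(p, q) \<in> G\<close>, the relation \<open>G\<close> is a bounded operator on its
  domain, and \<open>dual_of G Z\<close> says that \<open>Z\<close> is its adjoint. Taking \<open>G = {(P x, T x)}\<close> gives polar
  decompositions, and taking for \<open>G\<close> the graph of an operator gives adjoints.\<close>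

definition linear_relation :: "('a \<times> 'b) set \<Rightarrow> bool" where
  "linear_relation G \<longleftrightarrow> (0, 0) \<in> G \<and>
     (\<forall>p q p' q'. (p, q) \<in> G \<longrightarrow> (p', q') \<in> G \<longrightarrow> (p + p', q + q') \<in> G) \<and>
     (\<forall>a p q. (p, q) \<in> G \<longrightarrow> (sc a p, sc' a q) \<in> G)"

definition dual_of :: "('a \<times> 'b) set \<Rightarrow> ('b \<Rightarrow> 'a) \<Rightarrow> bool" where
  "dual_of G Z \<longleftrightarrow> (\<forall>y. Z y \<in> hclosure ip (fst ` G)) \<and> (\<forall>p q y. (p, q) \<in> G \<longrightarrow> ip p (Z y) = ip' q y)"

lemma dual_of_ip: "dual_of G Z \<Longrightarrow> (p, q) \<in> G \<Longrightarrow> ip p (Z y) = ip' q y"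
  unfolding dual_of_def by blast

lemma dual_of_closure: "dual_of G Z \<Longrightarrow> Z y \<in> hclosure ip (fst ` G)"
  unfolding dual_of_def by blast

lemma linear_relation_subsp:
  assumes "linear_relation G"
  shows "A.subsp (fst ` G)"
  unfolding A.subsp_def
proof (intro conjI ballI allI)
  show "0 \<in> fst ` G" using assms unfolding linear_relation_def by (metis fst_conv image_eqI)
  fix x assume "x \<in> fst ` G"
  then obtain r where r: "(x, r) \<in> G" by auto
  have "(sc a x, sc' a r) \<in> G" for a using assms r unfolding linear_relation_def by blast
  then show "sc a x \<in> fst ` G" for a by (rule image_eqI[rotated]) simp
  fix y assume "y \<in> fst ` G"
  then obtain s where s: "(y, s) \<in> G" by auto
  have "(x + y, r + s) \<in> G" using assms r s unfolding linear_relation_def by blast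
  then show "x + y \<in> fst ` G" by (rule image_eqI[rotated]) simp
qed

text \<open>The closure condition in \<open>dual_of\<close> fixes the part of \<open>Z y\<close>
  that the pairing cannot see. Linearity and intertwining properties of \<open>Z\<close> all come
  from this uniqueness.\<close>

lemma dual_of_eqI:
  assumes Z: "dual_of G Z" and w: "w \<in> hclosure ip (fst ` G)"
    and "\<And>p q. (p, q) \<in> G \<Longrightarrow> ip p w = ip' q y"
  shows "Z y = w"
proof (rule A.hclosure_unique[OF dual_of_closure[OF Z] w])
  fix p assume "p \<in> fst ` G"
  then obtain q where "(p, q) \<in> G" by auto
  then show "ip p (Z y) = ip p w" using dual_of_ip[OF Z] assms(3) by simp
qed

text \<open>The bound makes the relation single-valued, so for each \<open>y\<close> the pairing of
  the second component with \<open>y\<close> is a bounded functional of the first, represented by a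
  vector in the closure of the domain.\<close>

lemma ex_dual:
  assumes G: "linear_relation G" and C: "0 \<le> C"
    and bnd: "\<And>p q. (p, q) \<in> G \<Longrightarrow> B.nrm q \<le> C * A.nrm p"
  shows "\<exists>Z. bop sc' ip' sc ip C Z \<and> dual_of G Z"
proof -
  have G0: "(0, 0) \<in> G"
    and Gadd: "\<And>p q p' q'. (p, q) \<in> G \<Longrightarrow> (p', q') \<in> G \<Longrightarrow> (p + p', q + q') \<in> G"
    and Gsc: "\<And>a p q. (p, q) \<in> G \<Longrightarrow> (sc a p, sc' a q) \<in> G"
    using G unfolding linear_relation_def by blast+
  have single: "q = q'" if "(p, q) \<in> G" "(p, q') \<in> G" for p q q'
  proof -
    \<comment> \<open>The difference of two pairs over the same \<open>p\<close> has first component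
      zero, so the bound annihilates its second component.\<close>
    have "(p + sc (- 1) p, q + sc' (- 1) q') \<in> G" by (intro Gadd Gsc that)
    then have "B.nrm (q - q') \<le> 0"
      using bnd[of 0 "q - q'"] by (simp add: A.sc_minus_left B.sc_minus_left)
    then show ?thesis using B.nrm_ge_zero[of "q - q'"] by (metis B.nrm_zero_iff eq_iff_diff_eq_0 order_antisym)
  qed
  have S: "A.subsp (fst ` G)" by (rule linear_relation_subsp[OF G])
  define q where "q p = (THE q. (p, q) \<in> G)" for p
  have q: "q p = r" if "(p, r) \<in> G" for p r
    unfolding q_def using single that by blast
  have ex: "\<exists>w\<in>hclosure ip (fst ` G). \<forall>p\<in>fst ` G. ip' (q p) y = ip p w" for y
  proof (rule A.riesz_subspace[OF S])
    fix p p' assume "p \<in> fst ` G" "p' \<in> fst ` G"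
    then obtain r r' where "(p, r) \<in> G" "(p', r') \<in> G" by auto
    then show "ip' (q (p + p')) y = ip' (q p) y + ip' (q p') y"
      using Gadd q by (metis B.ip_add_left)
  next
    fix a p assume "p \<in> fst ` G"
    then obtain r where "(p, r) \<in> G" by auto
    then show "ip' (q (sc a p)) y = a * ip' (q p) y"
      using Gsc q by (metis B.ip_sc_left)
  next
    fix p assume "p \<in> fst ` G"
    then obtain r where r: "(p, r) \<in> G" by auto
    have "cmod (ip' r y) \<le> B.nrm r * B.nrm y" by (rule B.cauchy_schwarz)
    also have "\<dots> \<le> C * A.nrm p * B.nrm y" by (intro mult_right_mono bnd r) simp
    finally show "cmod (ip' (q p) y) \<le> (C * B.nrm y) * A.nrm p" using q[OF r] by (simp add: ac_simps)
  qed
  then obtain Z where Z: "\<And>y. Z y \<in> hclosure ip (fst ` G)"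
    "\<And>y p. p \<in> fst ` G \<Longrightarrow> ip' (q p) y = ip p (Z y)"
    by metis
  have dual: "dual_of G Z"
    unfolding dual_of_def using Z q by (metis fst_conv image_eqI)
  \<comment> \<open>\<open>Z y\<close> is approximated from the domain, where the pairing is
    explicit; testing \<open>Z y\<close> against itself leaves one factor of its norm to
    cancel.\<close>
  have bound: "A.nrm (Z y) \<le> C * B.nrm y" for y
  proof -
    obtain s where s: "\<And>n. s n \<in> fst ` G" "A.tends s (Z y)"
      using A.mem_hclosure_seq[OF Z(1)] by blast
    have "cmod (ip (s n) (Z y)) \<le> C * B.nrm y * A.nrm (s n)" for n
    proof -
      obtain r where r: "(s n, r) \<in> G" using s(1)[of n] by auto
      have "cmod (ip (s n) (Z y)) = cmod (ip' r y)" by (simp add: dual_of_ip[OF dual r])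
      also have "\<dots> \<le> B.nrm r * B.nrm y" by (rule B.cauchy_schwarz)
      also have "\<dots> \<le> C * A.nrm (s n) * B.nrm y" by (intro mult_right_mono bnd r) simp
      finally show ?thesis by (simp add: ac_simps)
    qed
    moreover have "(\<lambda>n. cmod (ip (s n) (Z y))) \<longlonglongrightarrow> cmod (ip (Z y) (Z y))"
      by (intro tendsto_norm A.tends_ip_left s)
    moreover have "(\<lambda>n. C * B.nrm y * A.nrm (s n)) \<longlonglongrightarrow> C * B.nrm y * A.nrm (Z y)"
      by (intro tendsto_mult_left A.tends_nrm s)
    ultimately have "cmod (ip (Z y) (Z y)) \<le> C * B.nrm y * A.nrm (Z y)"
      by (meson LIMSEQ_le)
    then have *: "A.nrm (Z y) * A.nrm (Z y) \<le> C * B.nrm y * A.nrm (Z y)"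
      by (simp add: A.ip_self power2_eq_square norm_mult)
    show ?thesis
    proof (cases "A.nrm (Z y) = 0")
      case False
      then have "A.nrm (Z y) > 0" using A.nrm_ge_zero[of "Z y"] by linarith
      with * show ?thesis by simp
    qed (use C in simp)
  qed
  have closed: "A.subsp (hclosure ip (fst ` G))" by (rule A.subsp_hclosure[OF S])
  have "bop sc' ip' sc ip C Z"
  proof (rule bopI[OF C _ _ bound])
    show "Z (x + y) = Z x + Z y" for x y
      by (rule dual_of_eqI[OF dual])
        (use closed Z(1) dual_of_ip[OF dual] in
          \<open>auto simp: A.subsp_def A.ip_add_right B.ip_add_right\<close>)
    show "Z (sc' a x) = sc a (Z x)" for a x
      by (rule dual_of_eqI[OF dual])
        (use closed Z(1) dual_of_ip[OF dual] in \<open>auto simp: A.subsp_def\<close>)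
  qed
  with dual show ?thesis by blast
qed

text \<open>Invariance under \<open>(u, w)\<close> makes \<open>u'\<close> preserve the orthogonal
  complement of the domain, so \<open>u\<close> preserves its closure; invariance under the adjoint
  pair \<open>(u', w')\<close> gives the pairing identity. The route through the complement stands
  in for continuity of \<open>u\<close>.\<close>

lemma dual_commute:
  assumes Z: "dual_of G Z"
    and u: "\<And>x y. ip (u x) y = ip x (u' y)" and w: "\<And>x y. ip' (w x) y = ip' x (w' y)"
    and G: "\<And>p q. (p, q) \<in> G \<Longrightarrow> (u p, w q) \<in> G" "\<And>p q. (p, q) \<in> G \<Longrightarrow> (u' p, w' q) \<in> G"
    and lin: "linear_relation G"
  shows "Z (w y) = u (Z y)"
proof (rule dual_of_eqI[OF Z])
  have u': "ip x (u y) = ip (u' x) y" for x y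
  proof -
    have "ip x (u y) = cnj (ip (u y) x)" by (rule A.ip_commute)
    also have "\<dots> = ip (u' x) y" unfolding u by (rule A.ip_commute[symmetric])
    finally show ?thesis .
  qed
  have w': "ip' x (w y) = ip' (w' x) y" for x y
  proof -
    have "ip' x (w y) = cnj (ip' (w y) x)" by (rule B.ip_commute)
    also have "\<dots> = ip' (w' x) y" unfolding w by (rule B.ip_commute[symmetric])
    finally show ?thesis .
  qed
  show "u (Z y) \<in> hclosure ip (fst ` G)"
  proof (rule A.orthogonal_complement_complement[OF linear_relation_subsp[OF lin]])
    fix v assume v: "\<And>s. s \<in> fst ` G \<Longrightarrow> ip s v = 0"
    have "ip (Z y) (u' v) = 0"
    proof (rule A.hclosure_orthogonal[OF dual_of_closure[OF Z]])
      fix s assume "s \<in> fst ` G"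
      then have "u s \<in> fst ` G" using G(1) by force
      then show "ip s (u' v) = 0" using v[of "u s"] u by simp
    qed
    then show "ip (u (Z y)) v = 0" using u by simp
  qed
  fix p q assume "(p, q) \<in> G"
  then show "ip p (u (Z y)) = ip' q (w y)"
    using dual_of_ip[OF Z G(2)] by (simp add: u' w')
qed

lemma ex_adjoint:
  assumes T: "bop sc ip sc' ip' C T"
  shows "\<exists>S. bop sc' ip' sc ip C S \<and> (\<forall>x y. ip' (T x) y = ip x (S y))"
proof -
  let ?G = "range (\<lambda>x. (x, T x))"
  have "linear_relation ?G"
    unfolding linear_relation_def
    by (auto simp: bop_zero[OF T] bop_add[OF T] bop_sc[OF T])
  then obtain S where "bop sc' ip' sc ip C S" "dual_of ?G S"
    using ex_dual[OF _ bop_nonneg[OF T], of ?G] bop_bound[OF T] by blast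
  then show ?thesis using dual_of_ip by (metis rangeI)
qed

end

section \<open>Positive square roots\<close>

context chilbert
begin

definition pos_op :: "real \<Rightarrow> ('h \<Rightarrow> 'h) \<Rightarrow> bool" where
  "pos_op C P \<longleftrightarrow> bop sc ip sc ip C P \<and> (\<forall>x y. ip (P x) y = ip x (P y)) \<and> (\<forall>x. 0 \<le> Re (ip (P x) x))"

text \<open>Stands in for the statement that \<open>P\<close> is a strong limit of polynomials in
  \<open>B\<close>: \<open>P\<close> commutes with every bounded operator commuting with
  \<open>B\<close>.\<close>

definition bicommutes :: "('h \<Rightarrow> 'h) \<Rightarrow> ('h \<Rightarrow> 'h) \<Rightarrow> bool" where
  "bicommutes B P \<longleftrightarrow> (\<forall>u D. bop sc ip sc ip D u \<longrightarrow> (\<forall>x. u (B x) = B (u x)) \<longrightarrow>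
     (\<forall>x. u (P x) = P (u x)))"

lemma bicommutesD:
  "bicommutes B P \<Longrightarrow> bop sc ip sc ip D u \<Longrightarrow> (\<And>x. u (B x) = B (u x)) \<Longrightarrow> u (P x) = P (u x)"
  unfolding bicommutes_def by blast

lemma
  assumes "pos_op C P"
  shows pos_op_bop: "bop sc ip sc ip C P" and pos_op_herm: "ip (P x) y = ip x (P y)"
    and pos_op_nonneg: "0 \<le> Re (ip (P x) x)"
  using assms unfolding pos_op_def by blast+

lemma bop_tends_self: "bop sc ip sc ip C T \<Longrightarrow> tends X L \<Longrightarrow> tends (\<lambda>n. T (X n)) (T L)"
  by (rule chilbert_pair.bop_tends[OF chilbert_pair.intro[OF chilbert_axioms chilbert_axioms]])

text \<open>Positivity of \<open>A\<close> at \<open>x - A x\<close> says that A - 2 A^2 + A^3 is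
  nonnegative as a form. Bounding the first and last terms by the form inequality leaves the claim,
  without any norm formula for hermitian operators.\<close>

lemma contraction_of_form_le:
  assumes A: "\<And>x y. A (x - y) = A x - A y" "\<And>x y. ip (A x) y = ip x (A y)"
    "\<And>x. 0 \<le> Re (ip (A x) x)" "\<And>x. Re (ip (A x) x) \<le> (nrm x)\<^sup>2"
  shows "nrm (A x) \<le> nrm x"
proof (rule power2_le_imp_le)
  have "0 \<le> Re (ip (A (x - A x)) (x - A x))" by (rule A)
  also have "\<dots> = Re (ip (A x) x) - 2 * (nrm (A x))\<^sup>2 + Re (ip (A (A x)) (A x))"
    by (simp add: A(1) ip_diff_left ip_diff_right nrm_power2 flip: A(2))
  also have "\<dots> \<le> (nrm x)\<^sup>2 - (nrm (A x))\<^sup>2"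
    using A(4)[of x] A(4)[of "A x"] by simp
  finally show "(nrm (A x))\<^sup>2 \<le> (nrm x)\<^sup>2" by simp
qed simp

end

text \<open>Scalar majorant of the iteration \<open>X \<mapsto> (A + X\<^sup>2) / 2\<close>, whose limit is \<open>1 - sqrt (1 - A)\<close>
  for a contraction \<open>A\<close>.\<close>

primrec sqrt_majorant :: "nat \<Rightarrow> real" where
  "sqrt_majorant 0 = 0"
| "sqrt_majorant (Suc n) = (1 + (sqrt_majorant n)\<^sup>2) / 2"

lemma sqrt_majorant_bounds: "0 \<le> sqrt_majorant n \<and> sqrt_majorant n \<le> 1"
proof (induction n)
  case (Suc n)
  then have "(sqrt_majorant n)\<^sup>2 \<le> 1" by (simp add: power_le_one)
  then show ?case by simp
qed simp

lemma sqrt_majorant_mono: "sqrt_majorant n \<le> sqrt_majorant (Suc n)"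
proof -
  have "0 \<le> (1 - sqrt_majorant n)\<^sup>2" by simp
  then show ?thesis by (simp add: power2_diff)
qed

lemma incseq_sqrt_majorant: "incseq sqrt_majorant"
  using sqrt_majorant_mono by (rule incseq_SucI)

lemma Cauchy_sqrt_majorant: "Cauchy sqrt_majorant"
proof -
  obtain L where "sqrt_majorant \<longlonglongrightarrow> L"
    using incseq_convergent[OF incseq_sqrt_majorant, of 1] sqrt_majorant_bounds by blast
  then show ?thesis by (rule LIMSEQ_imp_Cauchy)
qed

context chilbert
begin

primrec sqrt_iter :: "('h \<Rightarrow> 'h) \<Rightarrow> nat \<Rightarrow> 'h \<Rightarrow> 'h" where
  "sqrt_iter A 0 x = 0"
| "sqrt_iter A (Suc n) x = sc (1/2) (A x + sqrt_iter A n (sqrt_iter A n x))"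

lemma sqrt_iter_bop:
  assumes A: "bop sc ip sc ip 1 A"
  shows "bop sc ip sc ip (sqrt_majorant n) (sqrt_iter A n)"
proof (induction n)
  case 0
  show ?case by (rule bopI) auto
next
  case (Suc n)
  let ?X = "sqrt_iter A n" and ?s = "sqrt_majorant n"
  show ?case
  proof (rule bopI)
    fix x
    have "nrm (?X (?X x)) \<le> ?s * nrm (?X x)" by (rule bop_bound[OF Suc])
    also have "\<dots> \<le> ?s * (?s * nrm x)"
      by (intro mult_left_mono bop_bound[OF Suc]) (simp add: sqrt_majorant_bounds)
    finally have "nrm (A x + ?X (?X x)) \<le> nrm x + ?s\<^sup>2 * nrm x"
      using nrm_triangle[of "A x" "?X (?X x)"] bop_bound[OF A, of x] by (simp add: power2_eq_square)
    then show "nrm (sqrt_iter A (Suc n) x) \<le> sqrt_majorant (Suc n) * nrm x"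
      by (simp add: field_simps)
  qed (use sqrt_majorant_bounds[of "Suc n"] in
      \<open>simp_all add: bop_add[OF A] bop_add[OF Suc] bop_sc[OF A] bop_sc[OF Suc] sc_add_right
        algebra_simps\<close>)
qed

text \<open>With \<open>X\<close>, \<open>Y\<close> consecutive iterates, Y^2 - X^2 = Y (Y - X) + (Y
  - X) X, which requires no commutation. The resulting bound t (t - s) + (t - s) s = t^2 - s^2 is
  twice the next increment of the scalar sequence.\<close>

lemma sqrt_iter_step:
  assumes A: "bop sc ip sc ip 1 A"
  shows "nrm (sqrt_iter A (Suc n) x - sqrt_iter A n x)
    \<le> (sqrt_majorant (Suc n) - sqrt_majorant n) * nrm x"
proof (induction n arbitrary: x)
  case 0
  show ?case using bop_bound[OF A, of x] by simp
next
  case (Suc n)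
  define X Y where "X = sqrt_iter A n" and "Y = sqrt_iter A (Suc n)"
  define s t where "s = sqrt_majorant n" and "t = sqrt_majorant (Suc n)"
  have Y: "bop sc ip sc ip t Y" unfolding Y_def t_def by (rule sqrt_iter_bop[OF A])
  have X: "bop sc ip sc ip s X" unfolding X_def s_def by (rule sqrt_iter_bop[OF A])
  have IH: "nrm (Y x - X x) \<le> (t - s) * nrm x" for x
    unfolding X_def Y_def s_def t_def by (rule Suc)
  have st: "0 \<le> s" "s \<le> t" using sqrt_majorant_bounds sqrt_majorant_mono by (simp_all add: s_def t_def del: sqrt_majorant.simps)
  have "sqrt_iter A (Suc (Suc n)) x - sqrt_iter A (Suc n) x
      = sc (1/2) (A x + Y (Y x)) - sc (1/2) (A x + X (X x))"
    by (simp add: X_def Y_def)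
  also have "\<dots> = sc (1/2) (Y (Y x - X x) + (Y (X x) - X (X x)))"
    by (simp add: bop_diff[OF Y] flip: sc_diff_right)
  finally have "nrm (sqrt_iter A (Suc (Suc n)) x - sqrt_iter A (Suc n) x)
      = nrm (Y (Y x - X x) + (Y (X x) - X (X x))) / 2"
    by simp
  also have "nrm (Y (Y x - X x) + (Y (X x) - X (X x))) \<le> t * ((t - s) * nrm x) + (t - s) * (s * nrm x)"
  proof (rule order_trans[OF nrm_triangle add_mono])
    show "nrm (Y (Y x - X x)) \<le> t * ((t - s) * nrm x)"
      using st by (intro order_trans[OF bop_bound[OF Y]] mult_left_mono IH) auto
    show "nrm (Y (X x) - X (X x)) \<le> (t - s) * (s * nrm x)"
      using st by (intro order_trans[OF IH] mult_left_mono bop_bound[OF X]) auto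
  qed
  also have "(t * ((t - s) * nrm x) + (t - s) * (s * nrm x)) / 2 = ((1 + t\<^sup>2) / 2 - (1 + s\<^sup>2) / 2) * nrm x"
    by (simp add: field_simps power2_eq_square)
  also have "(1 + t\<^sup>2) / 2 - (1 + s\<^sup>2) / 2 = sqrt_majorant (Suc (Suc n)) - sqrt_majorant (Suc n)"
    by (simp add: s_def t_def)
  finally show ?case by simp
qed

lemma sqrt_iter_Cauchy:
  assumes A: "bop sc ip sc ip 1 A"
  shows "nrm (sqrt_iter A m x - sqrt_iter A n x) \<le> \<bar>sqrt_majorant m - sqrt_majorant n\<bar> * nrm x"
proof -
  have *: "nrm (sqrt_iter A (n + k) x - sqrt_iter A n x) \<le> (sqrt_majorant (n + k) - sqrt_majorant n) * nrm x"
    for n k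
  proof (induction k)
    case (Suc k)
    then show ?case
      using nrm_triangle_diff[of "sqrt_iter A (n + Suc k) x" "sqrt_iter A n x" "sqrt_iter A (n + k) x"]
        sqrt_iter_step[OF A, of "n + k" x]
      by (simp add: left_diff_distrib del: sqrt_majorant.simps sqrt_iter.simps)
  qed simp
  show ?thesis
  proof (cases "n \<le> m")
    case True
    then obtain k where "m = n + k" using le_Suc_ex by blast
    then show ?thesis using *[of n k] incseqD[OF incseq_sqrt_majorant True] by simp
  next
    case False
    then obtain k where "n = m + k" by (metis le_Suc_ex nat_le_linear)
    then show ?thesis
      using *[of m k] incseqD[OF incseq_sqrt_majorant, of m n]
        nrm_minus_commute[of "sqrt_iter A m x"] by simp
  qed
qed

text \<open>The fixed point equation 2 X = A + X^2 is a rewriting of (1 - X)^2 = 1 - A. Commutation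
  with \<open>u\<close> holds for each iterate and survives the pointwise limit.\<close>

lemma sqrt_contraction:
  assumes A: "bop sc ip sc ip 1 A" and herm: "\<And>x y. ip (A x) y = ip x (A y)"
  obtains X where "bop sc ip sc ip 1 X" "\<And>x y. ip (X x) y = ip x (X y)"
    "\<And>x. sc 2 (X x) = A x + X (X x)"
    "bicommutes A X"
proof -
  define X where "X x = (SOME L. tends (\<lambda>n. sqrt_iter A n x) L)" for x
  have X: "tends (\<lambda>n. sqrt_iter A n x) (X x)" for x
    unfolding X_def
  proof (rule someI_ex, rule complete)
    fix e :: real assume e: "e > 0"
    have p: "e / (nrm x + 1) > 0" using e by (simp add: add_nonneg_pos)
    obtain N where N: "\<forall>m\<ge>N. \<forall>n\<ge>N. norm (sqrt_majorant m - sqrt_majorant n) < e / (nrm x + 1)"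
      using CauchyD[OF Cauchy_sqrt_majorant p] by blast
    have "nrm (sqrt_iter A m x - sqrt_iter A n x) < e" if "m \<ge> N" "n \<ge> N" for m n
    proof -
      have "\<bar>sqrt_majorant m - sqrt_majorant n\<bar> < e / (nrm x + 1)" using N that by simp
      then have "\<bar>sqrt_majorant m - sqrt_majorant n\<bar> * (nrm x + 1) < e"
        using nrm_ge_zero[of x] by (simp add: pos_less_divide_eq add_nonneg_pos)
      moreover have "\<bar>sqrt_majorant m - sqrt_majorant n\<bar> * nrm x
          \<le> \<bar>sqrt_majorant m - sqrt_majorant n\<bar> * (nrm x + 1)"
        by (intro mult_left_mono) auto
      ultimately show ?thesis using sqrt_iter_Cauchy[OF A, of m x n] by linarith
    qed
    then show "\<exists>N. \<forall>m\<ge>N. \<forall>n\<ge>N. nrm (sqrt_iter A m x - sqrt_iter A n x) < e" by blast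
  qed
  note iter = sqrt_iter_bop[OF A]
  have bound: "nrm (sqrt_iter A n x) \<le> nrm x" for n x
    using bop_bound[OF iter, of n x] mult_right_mono[of "sqrt_majorant n" 1 "nrm x"]
      sqrt_majorant_bounds[of n] by simp
  have bopX: "bop sc ip sc ip 1 X"
  proof (rule bopI)
    show "X (x + y) = X x + X y" for x y
      using tends_unique[OF X[of "x + y"]] tends_add[OF X X, of x y] by (simp add: bop_add[OF iter])
    show "X (sc a x) = sc a (X x)" for a x
      using tends_unique[OF X[of "sc a x"]] tends_sc[OF X, of a x] by (simp add: bop_sc[OF iter])
    show "nrm (X x) \<le> 1 * nrm x" for x
      using LIMSEQ_le_const2[OF tends_nrm[OF X]] bound by auto
  qed simp
  have herm_iter: "ip (sqrt_iter A n x) y = ip x (sqrt_iter A n y)" for n x y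
    by (induction n arbitrary: x y) (auto simp: herm ip_add_left ip_add_right)
  have hermX: "ip (X x) y = ip x (X y)" for x y
    using LIMSEQ_unique[OF tends_ip_left[OF X[of x], of y]] tends_ip_right[OF X[of y], of x]
    by (simp add: herm_iter)
  have XX: "tends (\<lambda>n. sqrt_iter A n (sqrt_iter A n x)) (X (X x))" for x
  proof (rule tendsI)
    show "nrm (sqrt_iter A n (sqrt_iter A n x) - X (X x))
        \<le> nrm (sqrt_iter A n x - X x) + nrm (sqrt_iter A n (X x) - X (X x))" for n
      using nrm_triangle_diff[of "sqrt_iter A n (sqrt_iter A n x)" "X (X x)" "sqrt_iter A n (X x)"]
        bound[of n "sqrt_iter A n x - X x"]
      by (simp add: bop_diff[OF iter])
    show "(\<lambda>n. nrm (sqrt_iter A n x - X x) + nrm (sqrt_iter A n (X x) - X (X x))) \<longlonglongrightarrow> 0"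
      using tendsto_add[OF X[of x] X[of "X x"]] by simp
  qed
  have eq: "sc 2 (X x) = A x + X (X x)" for x
  proof -
    have "tends (\<lambda>n. sqrt_iter A (Suc n) x) (X x)" by (rule LIMSEQ_Suc[OF X])
    then have "tends (\<lambda>n. sc (1/2) (A x + sqrt_iter A n (sqrt_iter A n x))) (X x)" by simp
    then have "X x = sc (1/2) (A x + X (X x))"
      by (rule tends_unique) (rule tends_sc[OF tends_add[OF tends_const XX]])
    then have "sc 2 (X x) = sc 2 (sc (1/2) (A x + X (X x)))" by simp
    then show ?thesis by simp
  qed
  have comm: "bicommutes A X"
    unfolding bicommutes_def
  proof (intro allI impI)
    fix u D x assume u: "bop sc ip sc ip D u" and "\<forall>x. u (A x) = A (u x)"
    then have c: "u (A x) = A (u x)" for x by blast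
    have "u (sqrt_iter A n x) = sqrt_iter A n (u x)" for n x
      by (induction n arbitrary: x) (simp_all add: bop_zero[OF u] bop_sc[OF u] bop_add[OF u] c)
    then show "u (X x) = X (u x)"
      using tends_unique[OF bop_tends_self[OF u X[of x]]] X[of "u x"] by simp
  qed
  show thesis by (rule that[OF bopX hermX eq comm])
qed

lemma ex_sqrt:
  assumes B: "pos_op C B"
  obtains P where "pos_op (2 * sqrt (C + 1)) P" "\<And>x. P (P x) = B x"
    "bicommutes B P"
proof -
  note bopB = pos_op_bop[OF B]
  \<comment> \<open>The shift keeps the scaling factor positive even for \<open>C = 0\<close>. Then
    \<open>A\<close> is 1 - B / c, a contraction, and the root of \<open>B\<close> is sqrt c times 1
    - X.\<close>
  define c where "c = C + 1"
  have c: "c > 0" using bop_nonneg[OF bopB] by (simp add: c_def)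
  define A where "A x = x - sc (1 / c) (B x)" for x
  have Aadd: "A (x + y) = A x + A y" and Adiff: "A (x - y) = A x - A y"
    and Asc: "A (sc a x) = sc a (A x)" for a x y
    by (simp_all add: A_def bop_add[OF bopB] bop_diff[OF bopB] bop_sc[OF bopB] sc_add_right sc_diff_right)
  have Aherm: "ip (A x) y = ip x (A y)" for x y
    by (simp add: A_def ip_diff_left ip_diff_right pos_op_herm[OF B])
  have form: "Re (ip (A x) x) = (nrm x)\<^sup>2 - Re (ip (B x) x) / c" for x
    by (simp add: A_def ip_diff_left nrm_power2)
  have le: "Re (ip (B x) x) \<le> c * (nrm x)\<^sup>2" for x
  proof -
    have "Re (ip (B x) x) \<le> nrm (B x) * nrm x"
      using cauchy_schwarz[of "B x" x] complex_Re_le_cmod order_trans by blast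
    also have "\<dots> \<le> (C * nrm x) * nrm x" by (intro mult_right_mono bop_bound[OF bopB]) simp
    also have "\<dots> \<le> c * (nrm x)\<^sup>2" by (simp add: c_def power2_eq_square algebra_simps)
    finally show ?thesis .
  qed
  have A: "bop sc ip sc ip 1 A"
  proof (rule bopI)
    have "nrm (A x) \<le> nrm x" for x
      by (rule contraction_of_form_le[OF Adiff Aherm])
        (use le pos_op_nonneg[OF B] c in \<open>simp_all add: form pos_divide_le_eq mult.commute\<close>)
    then show "nrm (A x) \<le> 1 * nrm x" for x by simp
  qed (simp_all add: Aadd Asc)
  obtain X where X: "bop sc ip sc ip 1 X" "\<And>x y. ip (X x) y = ip x (X y)"
    "\<And>x. sc 2 (X x) = A x + X (X x)"
    "bicommutes A X"
    by (rule sqrt_contraction[OF A Aherm]) (rule that)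
  define P where "P x = sc (sqrt c) (x - X x)" for x
  have "pos_op (2 * sqrt (C + 1)) P"
    unfolding pos_op_def
  proof (intro conjI allI)
    show "bop sc ip sc ip (2 * sqrt (C + 1)) P"
    proof (rule bopI)
      fix x
      have "nrm (x - X x) \<le> 2 * nrm x"
        using nrm_triangle[of x "- X x"] bop_bound[OF X(1), of x] by simp
      then show "nrm (P x) \<le> 2 * sqrt (C + 1) * nrm x"
        using c by (simp add: P_def c_def)
    qed (use c in \<open>simp_all add: P_def c_def bop_add[OF X(1)] bop_sc[OF X(1)] sc_add_right
        sc_diff_right mult.commute\<close>)
    show "ip (P x) y = ip x (P y)" for x y
      by (simp add: P_def ip_diff_left ip_diff_right X(2))
    fix x
    have "Re (ip (X x) x) \<le> nrm (X x) * nrm x"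
      using cauchy_schwarz[of "X x" x] complex_Re_le_cmod order_trans by blast
    also have "\<dots> \<le> nrm x * nrm x" using bop_bound[OF X(1), of x] by (intro mult_right_mono) auto
    finally show "0 \<le> Re (ip (P x) x)"
      using c by (simp add: P_def ip_diff_left ip_self power2_eq_square)
  qed
  moreover have "P (P x) = B x" for x
  proof -
    have "P (P x) = sc c ((x - X x) - X (x - X x))"
      using c by (simp add: P_def bop_sc[OF X(1)] bop_diff[OF X(1)] sc_diff_right flip: of_real_mult)
    also have "(x - X x) - X (x - X x) = x - (X x + X x) + X (X x)"
      by (simp add: bop_diff[OF X(1)])
    also have "X x + X x = A x + X (X x)"
      unfolding X(3)[symmetric] using sc_add_left[of 1 1 "X x"] by simp
    also have "x - (A x + X (X x)) + X (X x) = sc (1 / c) (B x)" by (simp add: A_def)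
    also have "sc c (sc (1 / c) (B x)) = B x" using c by simp
    finally show ?thesis .
  qed
  moreover have "bicommutes B P"
    unfolding bicommutes_def
  proof (intro allI impI)
    fix u D x assume u: "bop sc ip sc ip D u" and uB: "\<forall>x. u (B x) = B (u x)"
    have "u (A x) = A (u x)" for x by (simp add: A_def bop_diff[OF u] bop_sc[OF u] uB)
    then show "u (P x) = P (u x)"
      using bicommutesD[OF X(4) u] by (simp add: P_def bop_sc[OF u] bop_diff[OF u])
  qed
  ultimately show thesis by (rule that)
qed

section \<open>Uniqueness of positive square roots\<close>

lemma pos_op_square:
  assumes "pos_op C P"
  shows "ip (P (P x)) x = of_real ((nrm (P x))\<^sup>2)"
  by (simp add: pos_op_herm[OF assms, of "P x"] ip_self)

text \<open>With P = Q^2 the form is the squared norm of \<open>Q y\<close>, so its vanishing forces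
  \<open>Q y = 0\<close>.\<close>

lemma pos_op_form_zero:
  assumes P: "pos_op C P" and y: "Re (ip (P y) y) = 0"
  shows "P y = 0"
proof -
  obtain Q where Q: "pos_op (2 * sqrt (C + 1)) Q" "\<And>x. Q (Q x) = P x"
    by (rule ex_sqrt[OF P]) (rule that)
  have "Q y = 0" using y pos_op_square[OF Q(1), of y] by (simp add: Q(2))
  then show ?thesis using Q(2)[of y] bop_zero[OF pos_op_bop[OF Q(1)]] by simp
qed

text \<open>For commuting roots the vector y = (P - Q) x satisfies (P + Q) y = 0. Both forms are
  nonnegative, so both vanish at \<open>y\<close>, which makes \<open>y\<close> orthogonal to
  itself. The general case compares both roots with a third one.\<close>

lemma sqrt_unique:
  assumes P: "pos_op C P" and Q: "pos_op D Q" and eq: "\<And>x. P (P x) = Q (Q x)"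
  shows "P = Q"
proof -
  have commuting: "P' = Q'" if P': "pos_op C' P'" and Q': "pos_op D' Q'"
    and eq': "\<And>x. P' (P' x) = Q' (Q' x)" and comm: "\<And>x. P' (Q' x) = Q' (P' x)" for P' Q' C' D'
  proof
    fix x
    note d = bop_diff[OF pos_op_bop[OF P']] bop_diff[OF pos_op_bop[OF Q']]
    define y where "y = P' x - Q' x"
    have "P' y + Q' y = 0" by (simp add: y_def d eq' comm)
    then have "Re (ip (P' y) y) + Re (ip (Q' y) y) = 0"
      by (metis ip_add_left ip_zero_left plus_complex.simps(1) zero_complex.simps(1))
    then have "Re (ip (P' y) y) = 0" "Re (ip (Q' y) y) = 0"
      using pos_op_nonneg[OF P', of y] pos_op_nonneg[OF Q', of y] by linarith+
    then have "P' y = 0" "Q' y = 0" using pos_op_form_zero P' Q' by blast+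
    then have "ip y y = 0"
      using pos_op_herm[OF P', of x y] pos_op_herm[OF Q', of x y] by (simp add: y_def ip_diff_left)
    then show "P' x = Q' x" using ip_self_zero y_def by fastforce
  qed
  have PP: "pos_op (C * C) (\<lambda>x. P (P x))"
    unfolding pos_op_def
  proof (intro conjI allI)
    show "bop sc ip sc ip (C * C) (\<lambda>x. P (P x))"
      by (rule bop_compose[OF pos_op_bop[OF P] pos_op_bop[OF P]])
    show "ip (P (P x)) y = ip x (P (P y))" for x y by (simp add: pos_op_herm[OF P])
    show "0 \<le> Re (ip (P (P x)) x)" for x by (simp add: pos_op_square[OF P] del: of_real_power)
  qed
  \<comment> \<open>This \<open>R\<close> commutes with whatever commutes with the common square, in
    particular with both \<open>P\<close> and \<open>Q\<close>.\<close>
  obtain R where R: "pos_op (2 * sqrt (C * C + 1)) R" "\<And>x. R (R x) = P (P x)"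
    "bicommutes (\<lambda>x. P (P x)) R"
    by (rule ex_sqrt[OF PP]) (rule that)
  have "P = R"
    by (rule commuting[OF P R(1)]) (use R(2) bicommutesD[OF R(3) pos_op_bop[OF P]] in auto)
  moreover have "Q = R"
    by (rule commuting[OF Q R(1)]) (use R(2) bicommutesD[OF R(3) pos_op_bop[OF Q]] eq in auto)
  ultimately show ?thesis by simp
qed

text \<open>\<open>positive_op\<close> speaks of the quadratic form only. Hermitian symmetry is
  recovered by polarisation at x + y and x + i y.\<close>

lemma pos_op_of_form:
  assumes P: "bop sc ip sc ip C P"
    and form: "\<And>x. Im (ip (P x) x) = 0 \<and> 0 \<le> Re (ip (P x) x)"
  shows "pos_op C P"
  unfolding pos_op_def
proof (intro conjI allI P)
  show "0 \<le> Re (ip (P x) x)" for x using form by blast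
  note d = bop_add[OF P] bop_sc[OF P] ip_add_left ip_add_right
  show "ip (P x) y = ip x (P y)" for x y
  proof -
    define a b where "a = ip (P x) y" and "b = ip (P y) x"
    have "Im (a + b) = 0"
      using form[of "x + y"] form[of x] form[of y] by (simp add: d a_def b_def)
    moreover have "Im (\<i> * b - \<i> * a) = 0"
      using form[of "x + sc \<i> y"] form[of x] form[of y] by (simp add: d a_def b_def)
    ultimately have "a = cnj b" by (simp add: complex_eq_iff)
    then show ?thesis unfolding a_def b_def using ip_commute by metis
  qed
qed

end

section \<open>Polar decomposition\<close>

context chilbert_pair
begin

text \<open>In the decomposition T = V P with \<open>P\<close> the absolute value of
  \<open>T\<close>, the map \<open>Z\<close> is the adjoint of the partial isometry
  \<open>V\<close>, not \<open>V\<close> itself: it is the dual of the relation sending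
  \<open>P x\<close> to \<open>T x\<close>.\<close>

definition polar :: "('a \<Rightarrow> 'b) \<Rightarrow> ('a \<Rightarrow> 'a) \<Rightarrow> ('b \<Rightarrow> 'a) \<Rightarrow> bool" where
  "polar T P Z \<longleftrightarrow> (\<exists>D. A.pos_op D P) \<and> (\<forall>x y. ip (P (P x)) y = ip' (T x) (T y)) \<and>
     A.bicommutes (\<lambda>x. P (P x)) P \<and> bop sc' ip' sc ip 1 Z \<and> dual_of (range (\<lambda>x. (P x, T x))) Z"

lemma
  assumes "polar T P Z"
  shows polar_pos: "\<exists>D. A.pos_op D P"
    and polar_square: "ip (P (P x)) y = ip' (T x) (T y)"
    and polar_bicommutes: "A.bicommutes (\<lambda>x. P (P x)) P"
    and polar_bop: "bop sc' ip' sc ip 1 Z"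
    and polar_dual: "dual_of (range (\<lambda>x. (P x, T x))) Z"
  using assms unfolding polar_def by blast+

lemma polar_ip:
  assumes "polar T P Z"
  shows "ip (P x) (Z y) = ip' (T x) y"
  using polar_dual[OF assms] by (rule dual_of_ip) simp

lemma polar_nrm:
  assumes "polar T P Z"
  shows "A.nrm (P x) = B.nrm (T x)"
proof -
  obtain D where "A.pos_op D P" using polar_pos[OF assms] by blast
  then have "ip (P x) (P x) = ip' (T x) (T x)"
    using polar_square[OF assms, of x x] by (simp add: A.pos_op_herm)
  then show ?thesis by (simp add: hnorm_def)
qed

lemma ex_polar:
  assumes T: "bop sc ip sc' ip' C T"
  shows "\<exists>P Z. polar T P Z"
proof -
  obtain S where S: "bop sc' ip' sc ip C S" "\<And>x y. ip' (T x) y = ip x (S y)"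
    using ex_adjoint[OF T] by blast
  have form: "ip (S (T x)) y = ip' (T x) (T y)" for x y
  proof -
    have "ip (S (T x)) y = cnj (ip y (S (T x)))" by (rule A.ip_commute)
    also have "\<dots> = ip' (T x) (T y)" unfolding S(2)[symmetric] by (rule B.ip_commute[symmetric])
    finally show ?thesis .
  qed
  have "A.pos_op (C * C) (\<lambda>x. S (T x))"
    unfolding A.pos_op_def
    using bop_compose[OF T S(1)] by (simp add: form S(2) B.ip_ge_zero flip: S(2))
  then obtain P where P: "A.pos_op (2 * sqrt (C * C + 1)) P" "\<And>x. P (P x) = S (T x)"
    "A.bicommutes (\<lambda>x. S (T x)) P"
    by (rule A.ex_sqrt) (rule that)
  have Peq: "(\<lambda>x. P (P x)) = (\<lambda>x. S (T x))" by (simp add: P(2))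
  note bopP = A.pos_op_bop[OF P(1)]
  have "linear_relation (range (\<lambda>x. (P x, T x)))"
    unfolding linear_relation_def
    by (auto simp: bop_zero[OF bopP] bop_zero[OF T] simp flip: bop_add[OF bopP] bop_add[OF T]
        bop_sc[OF bopP] bop_sc[OF T] intro: rev_image_eqI[of 0])
  moreover have "B.nrm (T x) = A.nrm (P x)" for x
  proof -
    have "ip (P x) (P x) = ip' (T x) (T x)"
      using form[of x x] by (simp add: A.pos_op_herm[OF P(1)] flip: P(2))
    then show ?thesis by (simp add: hnorm_def)
  qed
  then have "\<And>p q. (p, q) \<in> range (\<lambda>x. (P x, T x)) \<Longrightarrow> B.nrm q \<le> 1 * A.nrm p"
    by auto
  ultimately obtain Z where "bop sc' ip' sc ip 1 Z" "dual_of (range (\<lambda>x. (P x, T x))) Z"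
    using ex_dual[OF _ zero_le_one] by blast
  then have "polar T P Z"
    unfolding polar_def Peq using P(1,3) P(2) form by auto
  then show ?thesis by blast
qed

text \<open>Since \<open>T\<close> intertwines both \<open>u\<close> and its adjoint with the
  operators on the other side, \<open>u\<close> commutes with the adjoint of \<open>T\<close>
  composed with \<open>T\<close>, hence with the root \<open>P\<close>. The relation defining
  \<open>Z\<close> is then invariant, and \<open>dual_commute\<close> applies.\<close>

lemma
  assumes pol: "polar T P Z" and T: "bop sc ip sc' ip' C T"
    and u: "bop sc ip sc ip D u" "bop sc ip sc ip D u'" "\<And>x y. ip (u x) y = ip x (u' y)"
    and w: "\<And>x y. ip' (w x) y = ip' x (w' y)"
    and Tu: "\<And>x. T (u x) = w (T x)" "\<And>x. T (u' x) = w' (T x)"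
  shows polar_commute_abs: "P (u x) = u (P x)" and polar_commute_dual: "Z (w y) = u (Z y)"
proof -
  have flip: "ip x (u y) = ip (u' x) y" for x y
  proof -
    have "ip x (u y) = cnj (ip (u y) x)" by (rule A.ip_commute)
    also have "\<dots> = ip (u' x) y" unfolding u(3) by (rule A.ip_commute[symmetric])
    finally show ?thesis .
  qed
  have flip': "ip' x (w y) = ip' (w' x) y" for x y
  proof -
    have "ip' x (w y) = cnj (ip' (w y) x)" by (rule B.ip_commute)
    also have "\<dots> = ip' (w' x) y" unfolding w by (rule B.ip_commute[symmetric])
    finally show ?thesis .
  qed
  have "u (P (P x)) = P (P (u x))" for x
    by (rule A.ip_eqI') (simp add: u(3) polar_square[OF pol] Tu w)
  then show uP: "P (u x) = u (P x)" for x
    using A.bicommutesD[OF polar_bicommutes[OF pol] u(1)] by metis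
  have "u' (P (P x)) = P (P (u' x))" for x
    by (rule A.ip_eqI') (simp add: polar_square[OF pol] Tu flip: flip flip')
  then have u'P: "P (u' x) = u' (P x)" for x
    using A.bicommutesD[OF polar_bicommutes[OF pol] u(2)] by metis
  obtain E where "A.pos_op E P" using polar_pos[OF pol] by blast
  note bopP = A.pos_op_bop[OF this]
  show "Z (w y) = u (Z y)"
  proof (rule dual_commute[OF polar_dual[OF pol] u(3) w])
    show "linear_relation (range (\<lambda>x. (P x, T x)))"
      unfolding linear_relation_def
      by (auto simp: bop_zero[OF bopP] bop_zero[OF T] simp flip: bop_add[OF bopP] bop_add[OF T]
          bop_sc[OF bopP] bop_sc[OF T] intro: rev_image_eqI[of 0])
  qed (auto simp flip: uP u'P Tu)
qed

end

section \<open>The Hilbert space of square summable functions\<close>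

text \<open>Operators in the definitions act on arbitrary functions and vanish outside
  \<open>l2\<close>. A type of its own makes linear identities unconditional and lets the Hilbert
  space locale apply.\<close>

typedef 'g ell2 = "l2 :: ('g \<Rightarrow> complex) set"
  morphisms coord Abs_ell2
  by (rule exI[of _ "\<lambda>_. 0"]) (simp add: l2_def)

lemma l2_zero: "(\<lambda>_. 0) \<in> l2"
  by (simp add: l2_def)

lemma l2_add:
  assumes "f \<in> l2" "h \<in> l2"
  shows "(\<lambda>g. f g + h g) \<in> l2"
proof -
  have "(\<lambda>g. 2 * (cmod (f g))\<^sup>2 + 2 * (cmod (h g))\<^sup>2) summable_on UNIV"
    using assms by (intro summable_on_add summable_on_cmult_right) (simp_all add: l2_def)
  moreover have "norm ((cmod (f g + h g))\<^sup>2) \<le> 2 * (cmod (f g))\<^sup>2 + 2 * (cmod (h g))\<^sup>2" for g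
  proof -
    have "(cmod (f g + h g))\<^sup>2 \<le> (cmod (f g) + cmod (h g))\<^sup>2"
      by (intro power_mono norm_triangle_ineq) simp
    also have "\<dots> \<le> 2 * (cmod (f g))\<^sup>2 + 2 * (cmod (h g))\<^sup>2"
      using sum_squares_bound[of "cmod (f g)" "cmod (h g)"] by (simp add: power2_sum)
    finally show ?thesis by simp
  qed
  ultimately have "(\<lambda>g. norm ((cmod (f g + h g))\<^sup>2)) summable_on UNIV"
    by (rule Infinite_Sum.abs_summable_on_comparison_test')
  then show ?thesis by (simp add: l2_def)
qed

lemma l2_cmult:
  assumes "f \<in> l2"
  shows "(\<lambda>g. c * f g) \<in> l2"
  using assms summable_on_cmult_right[of "\<lambda>g. (cmod (f g))\<^sup>2" UNIV "(cmod c)\<^sup>2"]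
  by (simp add: l2_def norm_mult power_mult_distrib)

lemma l2_uminus: "f \<in> l2 \<Longrightarrow> (\<lambda>g. - f g) \<in> l2"
  using l2_cmult[of f "-1"] by simp

lemma l2_diff: "f \<in> l2 \<Longrightarrow> h \<in> l2 \<Longrightarrow> (\<lambda>g. f g - h g) \<in> l2"
  using l2_add[of f "\<lambda>g. - h g"] l2_uminus[of h] by simp

lemma l2_prod_summable:
  assumes "f \<in> l2" "h \<in> l2"
  shows "(\<lambda>g. f g * cnj (h g)) summable_on UNIV"
proof (rule abs_summable_summable, rule Infinite_Sum.abs_summable_on_comparison_test')
  show "(\<lambda>g. (cmod (f g))\<^sup>2 + (cmod (h g))\<^sup>2) summable_on UNIV"
    using assms by (intro summable_on_add) (simp_all add: l2_def)
  fix g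
  have "2 * (cmod (f g) * cmod (h g)) \<le> (cmod (f g))\<^sup>2 + (cmod (h g))\<^sup>2"
    using sum_squares_bound[of "cmod (f g)" "cmod (h g)"] by simp
  moreover have "0 \<le> cmod (f g) * cmod (h g)" by simp
  ultimately show "norm (f g * cnj (h g)) \<le> (cmod (f g))\<^sup>2 + (cmod (h g))\<^sup>2"
    by (simp add: norm_mult del: mult_nonneg_nonneg)
qed

lemma delta_l2: "delta g \<in> l2"
proof -
  have "(\<lambda>x. (cmod (delta g x))\<^sup>2) = (\<lambda>x. if x = g then 1 else 0)"
    by (auto simp: delta_def)
  then show ?thesis
    unfolding l2_def mem_Collect_eq
    using summable_on_cong_neutral[of "{g}" UNIV "\<lambda>x. (cmod (delta g x))\<^sup>2" "\<lambda>x. (cmod (delta g x))\<^sup>2"]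
    by (auto simp: delta_def)
qed

instantiation ell2 :: (type) ab_group_add
begin

definition "0 = Abs_ell2 (\<lambda>_. 0)"
definition "x + y = Abs_ell2 (\<lambda>g. coord x g + coord y g)"
definition "- x = Abs_ell2 (\<lambda>g. - coord x g)"
definition "x - y = Abs_ell2 (\<lambda>g. coord x g - coord y g)"

lemma coord_zero [simp]: "coord 0 g = 0"
  and coord_add [simp]: "coord (x + y) g = coord x g + coord y g"
  and coord_uminus [simp]: "coord (- x) g = - coord x g"
  and coord_diff [simp]: "coord (x - y) g = coord x g - coord y g"
  by (simp_all add: zero_ell2_def plus_ell2_def uminus_ell2_def minus_ell2_def Abs_ell2_inverse
      l2_zero l2_add[OF coord coord] l2_diff[OF coord coord] l2_uminus[OF coord])

lemma ell2_eqI: "(\<And>g. coord x g = coord y g) \<Longrightarrow> x = y"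
  using coord_inject by blast

instance
  by standard (auto intro!: ell2_eqI)

end

definition esc :: "complex \<Rightarrow> 'g ell2 \<Rightarrow> 'g ell2" where
  "esc a x = Abs_ell2 (\<lambda>g. a * coord x g)"

definition eip :: "'g ell2 \<Rightarrow> 'g ell2 \<Rightarrow> complex" where
  "eip x y = l2_inner (coord x) (coord y)"

lemma coord_esc [simp]: "coord (esc a x) g = a * coord x g"
  by (simp add: esc_def Abs_ell2_inverse l2_cmult[OF coord])

lemma coord_sum: "coord (sum f A) g = (\<Sum>a\<in>A. coord (f a) g)"
  by (induction A rule: infinite_finite_induct) auto

lemma coord_square_summable: "(\<lambda>g. (cmod (coord x g))\<^sup>2) summable_on UNIV"
  using coord[of x] by (simp add: l2_def)

lemma l2_inner_self:
  assumes "f \<in> l2"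
  shows "l2_inner f f = of_real (infsum (\<lambda>g. (cmod (f g))\<^sup>2) UNIV)"
proof -
  have "((\<lambda>g. (cmod (f g))\<^sup>2) has_sum infsum (\<lambda>g. (cmod (f g))\<^sup>2) UNIV) UNIV"
    using assms by (simp add: l2_def)
  then have "((\<lambda>g. complex_of_real ((cmod (f g))\<^sup>2)) has_sum
      of_real (infsum (\<lambda>g. (cmod (f g))\<^sup>2) UNIV)) UNIV"
    by (rule has_sum_of_real)
  then show ?thesis
    unfolding l2_inner_def by (simp add: infsumI complex_norm_square del: of_real_power)
qed

lemma enrm_power2: "(hnorm eip x)\<^sup>2 = infsum (\<lambda>g. (cmod (coord x g))\<^sup>2) UNIV"
  by (simp add: hnorm_def eip_def l2_inner_self[OF coord] infsum_nonneg)

lemma enrm_has_sum: "((\<lambda>g. (cmod (coord x g))\<^sup>2) has_sum (hnorm eip x)\<^sup>2) UNIV"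
  by (simp add: enrm_power2 coord_square_summable)

lemma sum_le_enrm: "finite F \<Longrightarrow> (\<Sum>g\<in>F. (cmod (coord x g))\<^sup>2) \<le> (hnorm eip x)\<^sup>2"
  unfolding enrm_power2 by (rule finite_sum_le_infsum[OF coord_square_summable]) auto

lemma enrm_le:
  assumes "0 \<le> c" "\<And>F. finite F \<Longrightarrow> (\<Sum>g\<in>F. (cmod (coord x g))\<^sup>2) \<le> c\<^sup>2"
  shows "hnorm eip x \<le> c"
proof -
  have "(hnorm eip x)\<^sup>2 \<le> c\<^sup>2"
    unfolding enrm_power2 by (rule infsum_le_finite_sums[OF coord_square_summable]) (rule assms)
  then show ?thesis using assms(1) by (rule power2_le_imp_le)
qed

lemma l2I:
  assumes "\<And>F. finite F \<Longrightarrow> (\<Sum>g\<in>F. (cmod (f g))\<^sup>2) \<le> c"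
  shows "f \<in> l2"
  unfolding l2_def mem_Collect_eq
  by (rule nonneg_bdd_above_summable_on) (auto intro!: bdd_aboveI2 assms)

lemma cmod_coord_le: "cmod (coord x g) \<le> hnorm eip x"
proof (rule power2_le_imp_le)
  show "(cmod (coord x g))\<^sup>2 \<le> (hnorm eip x)\<^sup>2" using sum_le_enrm[of "{g}" x] by simp
  show "0 \<le> hnorm eip x"
    by (simp add: hnorm_def eip_def l2_inner_self[OF coord] infsum_nonneg)
qed

text \<open>The pointwise limit exists because coordinates are bounded by the norm. Bounds on finite
  partial sums survive this limit, which yields both membership in \<open>l2\<close> and norm
  convergence.\<close>

lemma ell2_complete:
  fixes X :: "nat \<Rightarrow> 'g ell2"
  assumes C: "\<And>e. e > 0 \<Longrightarrow> \<exists>N. \<forall>m\<ge>N. \<forall>n\<ge>N. hnorm eip (X m - X n) < e"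
  shows "\<exists>L. (\<lambda>n. hnorm eip (X n - L)) \<longlonglongrightarrow> 0"
proof -
  have "Cauchy (\<lambda>n. coord (X n) g)" for g
  proof (rule CauchyI)
    fix e :: real assume "e > 0"
    then obtain N where "\<forall>m\<ge>N. \<forall>n\<ge>N. hnorm eip (X m - X n) < e" using C by blast
    then have "\<forall>m\<ge>N. \<forall>n\<ge>N. norm (coord (X m) g - coord (X n) g) < e"
      by (metis cmod_coord_le coord_diff le_less_trans)
    then show "\<exists>M. \<forall>m\<ge>M. \<forall>n\<ge>M. norm (coord (X m) g - coord (X n) g) < e" by blast
  qed
  then have "\<exists>l. (\<lambda>n. coord (X n) g) \<longlonglongrightarrow> l" for g
    by (simp add: Cauchy_convergent_iff convergent_def)
  then obtain f where f: "\<And>g. (\<lambda>n. coord (X n) g) \<longlonglongrightarrow> f g" by metis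
  have tail: "\<exists>N. \<forall>n\<ge>N. \<forall>F. finite F \<longrightarrow> (\<Sum>g\<in>F. (cmod (f g - coord (X n) g))\<^sup>2) \<le> e\<^sup>2"
    if e: "e > 0" for e
  proof -
    obtain N where N: "\<And>m n. m \<ge> N \<Longrightarrow> n \<ge> N \<Longrightarrow> hnorm eip (X m - X n) < e"
      using C[OF e] by blast
    have "(\<Sum>g\<in>F. (cmod (f g - coord (X n) g))\<^sup>2) \<le> e\<^sup>2" if "n \<ge> N" "finite F" for n F
    proof (rule LIMSEQ_le_const2)
      show "(\<lambda>m. \<Sum>g\<in>F. (cmod (coord (X m) g - coord (X n) g))\<^sup>2)
          \<longlonglongrightarrow> (\<Sum>g\<in>F. (cmod (f g - coord (X n) g))\<^sup>2)"
        by (intro tendsto_intros f)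
      have "(\<Sum>g\<in>F. (cmod (coord (X m) g - coord (X n) g))\<^sup>2) \<le> e\<^sup>2" if "m \<ge> N" for m
      proof -
        have "(\<Sum>g\<in>F. (cmod (coord (X m) g - coord (X n) g))\<^sup>2) \<le> (hnorm eip (X m - X n))\<^sup>2"
          using sum_le_enrm[OF \<open>finite F\<close>, of "X m - X n"] by simp
        also have "\<dots> \<le> e\<^sup>2"
          using N[OF that \<open>n \<ge> N\<close>]
          by (intro power_mono) (simp_all add: hnorm_def eip_def l2_inner_self[OF coord] infsum_nonneg)
        finally show ?thesis .
      qed
      then show "\<exists>N. \<forall>m\<ge>N. (\<Sum>g\<in>F. (cmod (coord (X m) g - coord (X n) g))\<^sup>2) \<le> e\<^sup>2" by blast
    qed
    then show ?thesis by blast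
  qed
  have fX: "(\<lambda>g. f g - coord (X n) g) \<in> l2"
    if "\<forall>F. finite F \<longrightarrow> (\<Sum>g\<in>F. (cmod (f g - coord (X n) g))\<^sup>2) \<le> e\<^sup>2" for n e
    using that by (intro l2I) blast
  obtain N where "\<forall>n\<ge>N. \<forall>F. finite F \<longrightarrow> (\<Sum>g\<in>F. (cmod (f g - coord (X n) g))\<^sup>2) \<le> 1\<^sup>2"
    using tail[of 1] by auto
  then have "(\<lambda>g. f g - coord (X N) g) \<in> l2" by (intro fX) blast
  then have "f \<in> l2" using l2_add[OF _ coord[of "X N"]] by fastforce
  then have L: "coord (Abs_ell2 f) g = f g" for g by (simp add: Abs_ell2_inverse)
  have "(\<lambda>n. hnorm eip (X n - Abs_ell2 f)) \<longlonglongrightarrow> 0"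
  proof (rule LIMSEQ_I)
    fix r :: real assume r: "r > 0"
    obtain N where N: "\<And>n F. n \<ge> N \<Longrightarrow> finite F \<Longrightarrow> (\<Sum>g\<in>F. (cmod (f g - coord (X n) g))\<^sup>2) \<le> (r/2)\<^sup>2"
      using tail[of "r/2"] r by auto
    have "norm (hnorm eip (X n - Abs_ell2 f) - 0) < r" if "n \<ge> N" for n
    proof -
      have "hnorm eip (X n - Abs_ell2 f) \<le> r/2"
        using r N[OF that] by (intro enrm_le) (auto simp: L norm_minus_commute)
      moreover have "0 \<le> hnorm eip (X n - Abs_ell2 f)"
        by (simp add: hnorm_def eip_def l2_inner_self[OF coord] infsum_nonneg)
      ultimately show ?thesis using r by simp
    qed
    then show "\<exists>no. \<forall>n\<ge>no. norm (hnorm eip (X n - Abs_ell2 f) - 0) < r" by blast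
  qed
  then show ?thesis by blast
qed

lemma complex_hilbert_space_ell2: "complex_hilbert_space (esc :: complex \<Rightarrow> 'g ell2 \<Rightarrow> 'g ell2) eip"
  unfolding complex_hilbert_space_def
proof (intro conjI allI impI)
  note prod = l2_prod_summable[OF coord coord]
  show "eip (x + y) z = eip x z + eip y z" for x y z :: "'g ell2"
    using infsum_add[OF prod[of x z] prod[of y z]] by (simp add: eip_def l2_inner_def distrib_right)
  show "eip (esc a x) y = a * eip x y" for a and x y :: "'g ell2"
    by (simp add: eip_def l2_inner_def mult.assoc infsum_cmult_right')
  show "eip y x = cnj (eip x y)" for x y :: "'g ell2"
    by (simp add: eip_def l2_inner_def mult.commute flip: infsum_cnj)
  show "0 \<le> Re (eip x x)" for x :: "'g ell2"
    by (simp add: eip_def l2_inner_self[OF coord] infsum_nonneg)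
  show "x = 0" if "eip x x = 0" for x :: "'g ell2"
  proof (rule ell2_eqI)
    have "infsum (\<lambda>g. (cmod (coord x g))\<^sup>2) UNIV = 0"
      using that by (simp add: eip_def l2_inner_self[OF coord])
    then have "(cmod (coord x g))\<^sup>2 = 0" for g
      using nonneg_infsum_le_0D[OF _ coord_square_summable[of x]] by simp
    then show "coord x g = coord 0 g" for g by simp
  qed
  show "\<exists>L. (\<lambda>n. hnorm eip (X n - L)) \<longlonglongrightarrow> 0"
    if "\<forall>e>0. \<exists>N. \<forall>m\<ge>N. \<forall>n\<ge>N. hnorm eip (X m - X n) < e" for X :: "nat \<Rightarrow> 'g ell2"
    using that by (intro ell2_complete) blast
qed (auto intro!: ell2_eqI simp: algebra_simps)

interpretation E: chilbert esc eip
  by unfold_locales (rule complex_hilbert_space_ell2)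

definition edelta :: "'g \<Rightarrow> 'g ell2" where
  "edelta g = Abs_ell2 (delta g)"

lemma coord_edelta: "coord (edelta g) = delta g"
  by (simp add: edelta_def Abs_ell2_inverse delta_l2)

lemma eip_edelta: "eip x (edelta g) = coord x g"
proof -
  have "eip x (edelta g) = (\<Sum>\<^sub>\<infinity>h\<in>{g}. coord x h * cnj (delta g h))"
    unfolding eip_def l2_inner_def coord_edelta by (rule infsum_cong_neutral) (auto simp: delta_def)
  then show ?thesis by (simp add: delta_def)
qed

text \<open>One construction for left translation, right translation and translation in every copy
  of a multiple. It is meaningful when the composite is again square summable, which the facts below
  secure by bijectivity of \<open>f\<close>.\<close>

definition reindex :: "('i \<Rightarrow> 'g) \<Rightarrow> 'g ell2 \<Rightarrow> 'i ell2" where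
  "reindex f x = Abs_ell2 (\<lambda>g. coord x (f g))"

lemma coord_reindex:
  assumes "bij f"
  shows "coord (reindex f x) g = coord x (f g)"
proof -
  have "(\<lambda>g. coord x (f g)) \<in> l2"
    using coord_square_summable[of x] assms
    by (simp add: l2_def summable_on_reindex_bij_betw[of f UNIV UNIV "\<lambda>g. (cmod (coord x g))\<^sup>2"])
  then show ?thesis by (simp add: reindex_def Abs_ell2_inverse)
qed

lemma eip_reindex:
  assumes "bij f"
  shows "eip (reindex f x) (reindex f y) = eip x y"
  unfolding eip_def l2_inner_def coord_reindex[OF assms]
  by (rule infsum_reindex_bij_betw) (use assms in simp)

lemma bop_reindex: "bij f \<Longrightarrow> bop esc eip esc eip 1 (reindex f)"
  by (intro bopI) (auto intro!: ell2_eqI simp: coord_reindex hnorm_def eip_reindex)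

section \<open>Translations and the trace norm\<close>

interpretation EE: chilbert_pair esc eip esc eip ..

lemma hnorm_eip_nonneg: "0 \<le> hnorm eip x"
  by (rule E.nrm_ge_zero)

text \<open>Left translations commute with right translations, hence with every
  \<open>eop a\<close>. This commutation is what the polar parts and the trace argument rest
  on.\<close>

definition ltr :: "'g::group_add \<Rightarrow> 'g ell2 \<Rightarrow> 'g ell2" where
  "ltr g = reindex (\<lambda>x. - g + x)"

lemma bij_add_left: "bij (\<lambda>x. (a :: 'g::group_add) + x)"
  by (rule o_bij[of "\<lambda>x. - a + x"]) (auto simp: fun_eq_iff simp flip: add.assoc)

lemma bij_add_right: "bij (\<lambda>x. x + (a :: 'g::group_add))"
  by (rule o_bij[of "\<lambda>x. x + - a"]) (auto simp: fun_eq_iff add.assoc)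

lemma coord_ltr [simp]: "coord (ltr g x) h = coord x (- g + h)"
  unfolding ltr_def by (rule coord_reindex[OF bij_add_left])

lemma ltr_ltr: "ltr g (ltr h x) = ltr (g + h) x"
  by (rule ell2_eqI) (simp add: minus_add add.assoc del: add_uminus_conv_diff)

lemma ltr_zero [simp]: "ltr 0 x = x"
  by (rule ell2_eqI) simp

lemma bop_ltr: "bop esc eip esc eip 1 (ltr g)"
  unfolding ltr_def by (rule bop_reindex[OF bij_add_left])

lemma ltr_adjoint: "eip (ltr g x) y = eip x (ltr (- g) y)"
proof -
  have "eip (ltr g x) y = eip (ltr (- g) (ltr g x)) (ltr (- g) y)"
    unfolding ltr_def[of "- g"] by (rule eip_reindex[OF bij_add_left, symmetric])
  then show ?thesis by (simp add: ltr_ltr)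
qed

lemma ltr_edelta: "ltr g (edelta h) = edelta (g + h)"
proof -
  have "- g + x = h \<longleftrightarrow> x = g + h" for x
    by (metis add_minus_cancel minus_add_cancel)
  then show ?thesis by (intro ell2_eqI) (simp add: coord_edelta delta_def)
qed

definition eop :: "('g::group_add \<Rightarrow> complex) \<Rightarrow> 'g ell2 \<Rightarrow> 'g ell2" where
  "eop a x = (\<Sum>g\<in>{g. a g \<noteq> 0}. esc (a g) (reindex (\<lambda>h. h + g) x))"

lemma coord_eop_sum: "coord (eop a x) h = (\<Sum>g\<in>{g. a g \<noteq> 0}. a g * coord x (h + g))"
  by (simp add: eop_def coord_sum coord_reindex[OF bij_add_right])

lemma coord_eop: "coord (eop a x) = spanop a (coord x)"
  by (rule ext) (simp add: coord_eop_sum spanop_def rho_def coord)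

lemma coord_eop_edelta:
  assumes "finsupp a"
  shows "coord (eop a (edelta g)) 0 = a g"
  using assms by (simp add: coord_eop_sum coord_edelta delta_def finsupp_def if_distrib
      sum.delta cong: if_cong)

lemma bop_esc:
  assumes "bop sc ip esc eip C T"
  shows "bop sc ip esc eip (cmod a * C) (\<lambda>x. esc a (T x))"
proof (rule bopI)
  show "hnorm eip (esc a (T x)) \<le> cmod a * C * hnorm ip x" for x
    using bop_bound[OF assms, of x] by (simp add: mult.assoc mult_left_mono)
qed (use bop_nonneg[OF assms] in
    \<open>simp_all add: bop_add[OF assms] bop_sc[OF assms] E.sc_add_right mult.commute\<close>)

lemma bop_sum_ops:
  assumes "finite F" "\<And>g. g \<in> F \<Longrightarrow> \<exists>C. bop esc eip esc eip C (T g)"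
  shows "\<exists>C. bop esc eip esc eip C (\<lambda>x. \<Sum>g\<in>F. T g x)"
  using assms
proof (induction F rule: finite_induct)
  case empty
  have "bop esc eip esc eip 0 (\<lambda>_. 0)" by (rule bopI) auto
  then show ?case by auto
next
  case (insert g F)
  then obtain C D where C: "bop esc eip esc eip C (T g)"
    and D: "bop esc eip esc eip D (\<lambda>x. \<Sum>g\<in>F. T g x)" by fastforce
  have "bop esc eip esc eip (C + D) (\<lambda>x. T g x + (\<Sum>g\<in>F. T g x))"
  proof (rule bopI)
    show "hnorm eip (T g x + (\<Sum>g\<in>F. T g x)) \<le> (C + D) * hnorm eip x" for x
      using E.nrm_triangle[of "T g x" "\<Sum>g\<in>F. T g x"] bop_bound[OF C, of x] bop_bound[OF D, of x]
      by (simp add: distrib_right)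
    show "0 \<le> C + D" using bop_nonneg[OF C] bop_nonneg[OF D] by simp
  qed (simp_all add: bop_add[OF C] bop_add[OF D] bop_sc[OF C] bop_sc[OF D] E.sc_add_right)
  then show ?case using insert.hyps by auto
qed

lemma ex_bop_eop:
  assumes "finsupp a"
  shows "\<exists>C. bop esc eip esc eip C (eop a)"
  unfolding eop_def
  by (rule bop_sum_ops) (use assms bop_esc[OF bop_reindex[OF bij_add_right]] in \<open>auto simp: finsupp_def\<close>)

lemma eop_ltr: "eop a (ltr g x) = ltr g (eop a x)"
  by (rule ell2_eqI) (simp add: coord_eop_sum add.assoc)

section \<open>Identification of \<open>abs_op\<close>, the trace property and factorisation\<close>

lemma coord_Abs_l2: "f \<in> l2 \<Longrightarrow> coord (Abs_ell2 f) = f"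
  by (rule Abs_ell2_inverse)

text \<open>Any candidate for the definite description restricts to an operator on
  \<open>ell2\<close>, positive by \<open>E.pos_op_of_form\<close>, with the same square as
  \<open>P\<close>. It agrees with \<open>P\<close> by uniqueness of roots, and outside
  \<open>l2\<close> both are zero.\<close>

lemma abs_op_eq:
  fixes T :: "'g ell2 \<Rightarrow> 'g ell2"
  assumes P: "E.pos_op C P" and PP: "\<And>x y. eip (P (P x)) y = eip (T x) (T y)"
    and F: "\<And>x. F (coord x) = coord (T x)"
  shows "abs_op F = (\<lambda>f. if f \<in> l2 then coord (P (Abs_ell2 f)) else (\<lambda>_. 0))"
proof -
  define p where "p = (\<lambda>f. if f \<in> l2 then coord (P (Abs_ell2 f)) else (\<lambda>_. 0))"
  note bopP = E.pos_op_bop[OF P]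
  have nrm: "l2_norm (coord x) = hnorm eip x" for x :: "'g ell2"
    by (simp add: l2_norm_def hnorm_def eip_def)
  have p: "p (coord x) = coord (P x)" for x
    by (simp add: p_def coord coord_inverse)
  have all_l2: "(\<forall>f\<in>l2. R f) \<longleftrightarrow> (\<forall>x :: 'g ell2. R (coord x))" for R
    by (metis coord coord_Abs_l2)
  have add: "(\<lambda>g. coord x g + coord y g) = coord (x + y)"
    and cm: "(\<lambda>g. a * coord x g) = coord (esc a x)" for x y :: "'g ell2" and a
    by auto
  let ?spec = "\<lambda>P. positive_op P \<and>
    (\<forall>f\<in>l2. \<forall>h\<in>l2. l2_inner (P (P f)) h = l2_inner (F f) (F h))"
  have "?spec p"
    unfolding positive_op_def all_l2 add cm p nrm F
  proof (intro conjI allI impI)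
    show "p f = (\<lambda>_. 0)" if "f \<notin> l2" for f using that by (simp add: p_def)
    show "coord (P x) \<in> l2" for x by (rule coord)
    show "coord (P (x + y)) = coord (P x + P y)" for x y by (simp add: bop_add[OF bopP])
    show "coord (P (esc a x)) = coord (esc a (P x))" for a x by (simp add: bop_sc[OF bopP])
    show "\<exists>C. \<forall>x. hnorm eip (P x) \<le> C * hnorm eip x" using bop_bound[OF bopP] by blast
    show "Im (l2_inner (coord (P x)) (coord x)) = 0" for x
    proof -
      have "eip (P x) x = cnj (eip (P x) x)"
        using E.ip_commute[of x "P x"] E.pos_op_herm[OF P, of x x] by simp
      then show ?thesis by (simp add: eip_def complex_eq_iff)
    qed
    show "0 \<le> Re (l2_inner (coord (P x)) (coord x))" for x
      using E.pos_op_nonneg[OF P, of x] by (simp add: eip_def)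
    show "l2_inner (coord (P (P x))) (coord y) = l2_inner (coord (T x)) (coord (T y))" for x y
      using PP[of x y] by (simp add: eip_def)
  qed
  moreover have "q = p" if "?spec q" for q
  proof -
    have pos: "positive_op q"
      and sq: "\<And>x y. l2_inner (q (q (coord x))) (coord y) = l2_inner (coord (T x)) (coord (T y))"
      using that unfolding all_l2 F by blast+
    define Q where "Q x = Abs_ell2 (q (coord x))" for x
    have "coord (Q x) = q (coord x)" for x
      using pos unfolding positive_op_def all_l2 by (simp add: Q_def coord_Abs_l2)
    then have q: "q (coord x) = coord (Q x)" for x by simp
    have qout: "q f = (\<lambda>_. 0)" if "f \<notin> l2" for f
      using pos that unfolding positive_op_def by blast
    have Qadd: "Q (x + y) = Q x + Q y" and Qsc: "Q (esc a x) = esc a (Q x)" for x y a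
      using pos unfolding positive_op_def all_l2 add cm q coord_inject by blast+
    obtain D where D: "\<And>x. hnorm eip (Q x) \<le> D * hnorm eip x"
      using pos unfolding positive_op_def all_l2 add cm q nrm by blast
    have form: "Im (eip (Q x) x) = 0 \<and> 0 \<le> Re (eip (Q x) x)" for x
      using pos unfolding positive_op_def all_l2 add cm q eip_def by blast
    \<comment> \<open>The bound in \<open>positive_op\<close> carries no sign, while
      \<open>bop\<close> asks for a nonnegative constant.\<close>
    have "bop esc eip esc eip (max D 0) Q"
    proof (rule bopI)
      show "hnorm eip (Q x) \<le> max D 0 * hnorm eip x" for x
        by (rule order_trans[OF D mult_right_mono]) (simp_all add: hnorm_eip_nonneg)
    qed (simp_all add: Qadd Qsc)
    then have "E.pos_op (max D 0) Q" using form by (rule E.pos_op_of_form)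
    moreover have "Q (Q x) = P (P x)" for x
      by (rule E.ip_eqI') (use sq[of x] PP[of x] in \<open>simp add: q eip_def\<close>)
    ultimately have "Q = P" using E.sqrt_unique P by blast
    show "q = p"
    proof
      fix f show "q f = p f"
      proof (cases "f \<in> l2")
        case True
        then show ?thesis using q[of "Abs_ell2 f"] p[of "Abs_ell2 f"] \<open>Q = P\<close> by (simp add: coord_Abs_l2)
      next
        case False
        then show ?thesis by (simp add: qout p_def)
      qed
    qed
  qed
  ultimately show ?thesis unfolding abs_op_def p_def[symmetric] by (rule the_equality)
qed

text \<open>This is the trace property \<open>\<tau> (S\<^sup>* S) = \<tau> (S S\<^sup>*)\<close>.\<close>

lemma trace_adjoint:
  assumes S: "\<And>g x. S (ltr g x) = ltr g (S x)" and adj: "\<And>x y. eip (S x) y = eip x (S' y)"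
  shows "hnorm eip (S (edelta 0)) = hnorm eip (S' (edelta 0))"
proof -
  \<comment> \<open>Moving the translation across \<open>S\<close> shows that the two vectors differ
    by inversion of the group and conjugation, which preserve the sum of squares.\<close>
  have "coord (S (edelta 0)) g = cnj (coord (S' (edelta 0)) (- g))" for g
  proof -
    have "coord (S (edelta 0)) g = eip (S (edelta 0)) (ltr g (edelta 0))"
      by (simp add: ltr_edelta eip_edelta)
    also have "\<dots> = eip (ltr (- g) (S (edelta 0))) (edelta 0)" by (simp add: ltr_adjoint)
    also have "\<dots> = eip (edelta (- g)) (S' (edelta 0))" by (simp add: adj ltr_edelta flip: S)
    also have "\<dots> = cnj (eip (S' (edelta 0)) (edelta (- g)))" by (rule E.ip_commute)
    finally show ?thesis by (simp add: eip_edelta)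
  qed
  then have "(hnorm eip (S (edelta 0)))\<^sup>2 = (\<Sum>\<^sub>\<infinity>g. (cmod (coord (S' (edelta 0)) (- g)))\<^sup>2)"
    unfolding enrm_power2 by simp
  also have "\<dots> = (hnorm eip (S' (edelta 0)))\<^sup>2"
    unfolding enrm_power2 by (rule infsum_reindex_bij_betw) (rule bij_uminus)
  finally show ?thesis by (simp add: power2_eq_iff_nonneg hnorm_eip_nonneg)
qed

text \<open>Write \<open>eop a\<close> as V P and let \<open>Q\<close> be the root of
  \<open>P\<close>. Then \<open>c\<close> is \<open>Q\<close> at the unit vector of the identity and
  \<open>d\<close> is \<open>Q\<close> after the adjoint of \<open>V\<close> at the same vector: one
  factor \<open>Q\<close> on each side reassembles \<open>P\<close>, and the trace norm is the
  squared norm of \<open>c\<close>.\<close>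

lemma coefficient_factorization:
  assumes a: "finsupp a"
  shows "\<exists>c d. (hnorm eip c)\<^sup>2 \<le> norm1 a \<and> (hnorm eip d)\<^sup>2 \<le> norm1 a \<and>
    (\<forall>g. eip (ltr g c) d = a g)"
proof -
  obtain C where T: "bop esc eip esc eip C (eop a)" using ex_bop_eop[OF a] by blast
  obtain P Z where pol: "EE.polar (eop a) P Z" using EE.ex_polar[OF T] by blast
  obtain D where P: "E.pos_op D P" using EE.polar_pos[OF pol] by blast
  note bopP = E.pos_op_bop[OF P]
  obtain Q where Q: "E.pos_op (2 * sqrt (D + 1)) Q" "\<And>x. Q (Q x) = P x" "E.bicommutes P Q"
    by (rule E.ex_sqrt[OF P]) (rule that)
  note bopQ = E.pos_op_bop[OF Q(1)]
  have PL: "P (ltr g x) = ltr g (P x)" and ZL: "Z (ltr g y) = ltr g (Z y)" for g x y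
    by (rule EE.polar_commute_abs[OF pol T bop_ltr bop_ltr[of "- g"]];
        simp add: ltr_adjoint eop_ltr)
      (rule EE.polar_commute_dual[OF pol T bop_ltr bop_ltr[of "- g"]];
        simp add: ltr_adjoint eop_ltr)
  have QL: "Q (ltr g x) = ltr g (Q x)" for g x
    using E.bicommutesD[OF Q(3) bop_ltr] PL by metis
  define c d where "c = Q (edelta 0)" and "d = Q (Z (edelta 0))"
  have "norm1 a = Re (eip (P (edelta 0)) (edelta 0))"
  proof -
    have "abs_op (spanop a) = (\<lambda>f. if f \<in> l2 then coord (P (Abs_ell2 f)) else (\<lambda>_. 0))"
      by (rule abs_op_eq[OF P EE.polar_square[OF pol]]) (simp add: coord_eop)
    then show ?thesis
      unfolding norm1_def tau_def eip_def coord_edelta by (simp add: delta_l2 edelta_def)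
  qed
  also have "\<dots> = (hnorm eip c)\<^sup>2"
    using E.pos_op_square[OF Q(1), of "edelta 0"] by (simp add: Q(2) c_def del: of_real_power)
  finally have c: "norm1 a = (hnorm eip c)\<^sup>2" .
  \<comment> \<open>The trace property exchanges \<open>Q\<close> after \<open>Z\<close> for the
    adjoint, \<open>Z'\<close> after \<open>Q\<close>, and \<open>Z'\<close> is a
    contraction.\<close>
  have d: "hnorm eip d \<le> hnorm eip c"
  proof -
    obtain Z' where Z': "bop esc eip esc eip 1 Z'" "\<And>x y. eip (Z x) y = eip x (Z' y)"
      using EE.ex_adjoint[OF EE.polar_bop[OF pol]] by blast
    have "hnorm eip (Q (Z (edelta 0))) = hnorm eip (Z' (Q (edelta 0)))"
      by (rule trace_adjoint) (simp_all add: ZL QL E.pos_op_herm[OF Q(1)] Z'(2))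
    then show ?thesis using bop_bound[OF Z'(1), of "Q (edelta 0)"] by (simp add: c_def d_def)
  qed
  have "eip (ltr g c) d = a g" for g
  proof -
    have "eip (ltr g c) d = eip (P (edelta g)) (Z (edelta 0))"
      by (simp add: c_def d_def ltr_edelta Q(2) flip: QL E.pos_op_herm[OF Q(1)])
    also have "\<dots> = eip (eop a (edelta g)) (edelta 0)" by (rule EE.polar_ip[OF pol])
    also have "\<dots> = a g" by (simp add: eip_edelta coord_eop_edelta[OF a])
    finally show ?thesis .
  qed
  moreover have "(hnorm eip d)\<^sup>2 \<le> norm1 a" unfolding c using d by (intro power_mono hnorm_eip_nonneg)
  ultimately show ?thesis using c by (intro exI[of _ c] exI[of _ d]) auto
qed

section \<open>Coefficients of summable sequences\<close>

lemma bij_add_left_snd: "bij (\<lambda>(k, x). (k, (a :: 'g::group_add) + x))"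
  by (rule o_bij[of "\<lambda>(k, x). (k, - a + x)"]) (auto simp: fun_eq_iff simp flip: add.assoc)

text \<open>A direct sum of countably many copies of the left regular representation; copy
  \<open>k\<close> will hold the factors of the \<open>k\<close>-th term of a series.\<close>

definition mltr :: "'g::group_add \<Rightarrow> (nat \<times> 'g) ell2 \<Rightarrow> (nat \<times> 'g) ell2" where
  "mltr g = reindex (\<lambda>(k, x). (k, - g + x))"

lemma coord_mltr [simp]: "coord (mltr g x) (k, h) = coord x (k, - g + h)"
  unfolding mltr_def by (simp add: coord_reindex[OF bij_add_left_snd])

lemma mltr_mltr: "mltr g (mltr h x) = mltr (g + h) x"
proof (rule ell2_eqI)
  show "coord (mltr g (mltr h x)) j = coord (mltr (g + h) x) j" for j
    by (cases j) (simp add: minus_add add.assoc del: add_uminus_conv_diff)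
qed

lemma mltr_zero [simp]: "mltr 0 x = x"
proof (rule ell2_eqI)
  show "coord (mltr 0 x) j = coord x j" for j by (cases j) simp
qed

lemma bop_mltr: "bop esc eip esc eip 1 (mltr g)"
  unfolding mltr_def by (rule bop_reindex[OF bij_add_left_snd])

lemma mltr_adjoint: "eip (mltr g x) y = eip x (mltr (- g) y)"
proof -
  have "eip (mltr g x) y = eip (mltr (- g) (mltr g x)) (mltr (- g) y)"
    unfolding mltr_def[of "- g"] by (rule eip_reindex[OF bij_add_left_snd, symmetric])
  then show ?thesis by (simp add: mltr_mltr)
qed

text \<open>\<open>rho g\<close> moves the unit vector at the identity to the one at
  \<open>- g\<close>. Traces against \<open>rho g\<close> thus read off coefficients at the inverse
  element.\<close>

lemma tau_spanop_rho:
  assumes "finsupp a"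
  shows "tau (\<lambda>f. spanop a (rho g f)) = a (- g)"
proof -
  have "x + g = 0 \<longleftrightarrow> x = - g" for x using add_eq_0_iff2 by blast
  moreover have "rho g (delta 0) = (\<lambda>x. delta 0 (x + g))" by (simp add: rho_def delta_l2)
  ultimately have "rho g (delta 0) = coord (edelta (- g))" by (simp add: coord_edelta delta_def)
  then have "tau (\<lambda>f. spanop a (rho g f)) = eip (eop a (edelta (- g))) (edelta 0)"
    by (simp add: tau_def eip_def coord_eop coord_edelta)
  then show ?thesis by (simp add: eip_edelta coord_eop_edelta[OF assms])
qed

text \<open>A telescoping series along a fast subsequence. The geometric bound starts at index
  \<open>Suc 0\<close>, since the initial term \<open>B 0\<close> is an entry of \<open>A\<close>
  and not a difference.\<close>

lemma L1_seq_summable_pieces: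
  assumes A: "L1_seq A" and z: "\<And>g. (\<lambda>n. A n g) \<longlonglongrightarrow> z g"
  shows "\<exists>B. (\<forall>k. finsupp (B k)) \<and> (\<forall>k. norm1 (B (Suc k)) \<le> (1/2) ^ k) \<and> (\<forall>g. (\<lambda>k. B k g) sums z g)"
proof -
  have "\<exists>N. \<forall>m\<ge>N. \<forall>n\<ge>N. norm1 (\<lambda>g. A m g - A n g) < (1/2) ^ k" for k
    using A unfolding L1_seq_def by (simp add: zero_less_power)
  then obtain N where N: "\<And>k m n. m \<ge> N k \<Longrightarrow> n \<ge> N k \<Longrightarrow> norm1 (\<lambda>g. A m g - A n g) < (1/2) ^ k"
    by metis
  \<comment> \<open>Adding up all earlier thresholds gives an increasing index sequence that
    dominates each \<open>N k\<close>; the summand \<open>k\<close> makes it tend to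
    infinity.\<close>
  define r where "r k = k + (\<Sum>i\<le>k. N i)" for k
  have rN: "N k \<le> r k" and rmono: "r k \<le> r (Suc k)" for k
    by (auto simp: r_def intro: trans_le_add2 member_le_sum)
  have rtop: "filterlim r at_top sequentially"
    by (rule filterlim_at_top_mono[OF filterlim_ident]) (simp add: r_def)
  define B where "B k = (case k of 0 \<Rightarrow> A (r 0) | Suc j \<Rightarrow> (\<lambda>g. A (r (Suc j)) g - A (r j) g))" for k
  have fin: "finsupp (A n)" for n using A unfolding L1_seq_def by blast
  have "finsupp (B k)" for k
  proof (cases k)
    case (Suc j)
    have "{g. B k g \<noteq> 0} \<subseteq> {g. A (r (Suc j)) g \<noteq> 0} \<union> {g. A (r j) g \<noteq> 0}"
      by (auto simp: B_def Suc)
    then show ?thesis using fin unfolding finsupp_def by (meson finite_UnI finite_subset)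
  qed (simp add: B_def fin)
  moreover have "norm1 (B (Suc k)) \<le> (1/2) ^ k" for k
    using N[of k "r (Suc k)" "r k"] rN[of k] rmono[of k] by (simp add: B_def)
  moreover have "(\<lambda>k. B k g) sums z g" for g
  proof -
    have "(\<Sum>k\<le>n. B k g) = A (r n) g" for n
      by (induction n) (simp_all add: B_def)
    moreover have "(\<lambda>n. A (r n) g) \<longlonglongrightarrow> z g" using z rtop by (rule filterlim_compose)
    ultimately show ?thesis by (simp add: sums_def_le)
  qed
  ultimately show ?thesis by blast
qed

lemma ell2_direct_sum:
  fixes c :: "nat \<Rightarrow> 'g ell2"
  assumes bnd: "\<And>n. (\<Sum>k<n. (hnorm eip (c k))\<^sup>2) \<le> S"
  shows "(\<lambda>(k, g). coord (c k) g) \<in> l2"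
proof (rule l2I)
  fix F :: "(nat \<times> 'g) set" assume F: "finite F"
  then obtain n where n: "fst ` F \<subseteq> {..<n}"
    using finite_nat_iff_bounded by blast
  have "(\<Sum>j\<in>F. (cmod ((\<lambda>(k, g). coord (c k) g) j))\<^sup>2)
      \<le> (\<Sum>j\<in>{..<n} \<times> snd ` F. (cmod ((\<lambda>(k, g). coord (c k) g) j))\<^sup>2)"
    using F n by (intro sum_mono2) force+
  also have "\<dots> = (\<Sum>k<n. \<Sum>g\<in>snd ` F. (cmod (coord (c k) g))\<^sup>2)"
    by (simp add: sum.cartesian_product split_beta)
  also have "\<dots> \<le> (\<Sum>k<n. (hnorm eip (c k))\<^sup>2)"
    using F by (intro sum_mono sum_le_enrm) simp
  also have "\<dots> \<le> S" by (rule bnd)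
  finally show "(\<Sum>j\<in>F. (cmod ((\<lambda>(k, g). coord (c k) g) j))\<^sup>2) \<le> S" .
qed

lemma L1_coefficients:
  fixes A :: "nat \<Rightarrow> 'g::group_add \<Rightarrow> complex"
  assumes A: "L1_seq A" and z: "\<And>g. (\<lambda>n. A n g) \<longlonglongrightarrow> z g"
  shows "\<exists>c d. \<forall>g. eip (mltr g c) d = z g"
proof -
  obtain B where fin: "\<And>k. finsupp (B k)" and small: "\<And>k. norm1 (B (Suc k)) \<le> (1/2) ^ k"
    and sums: "\<And>g. (\<lambda>k. B k g) sums z g"
    using L1_seq_summable_pieces[OF A z] by blast
  have "\<forall>k. \<exists>c d. (hnorm eip c)\<^sup>2 \<le> norm1 (B k) \<and> (hnorm eip d)\<^sup>2 \<le> norm1 (B k) \<and>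
      (\<forall>g. eip (ltr g c) d = B k g)"
    using coefficient_factorization[OF fin] by blast
  then obtain c d where c: "\<And>k. (hnorm eip (c k))\<^sup>2 \<le> norm1 (B k)"
    and d: "\<And>k. (hnorm eip (d k))\<^sup>2 \<le> norm1 (B k)"
    and cd: "\<And>k g. eip (ltr g (c k)) (d k) = B k g"
    by metis
  \<comment> \<open>Nonnegativity of the trace norm is read off from the factorisation, where it
    dominates a squared norm.\<close>
  have pos: "0 \<le> norm1 (B k)" for k using c[of k] zero_le_power2 order_trans by blast
  have "summable (\<lambda>k. norm1 (B (Suc k)))"
    by (rule summable_comparison_test'[OF summable_geometric[of "1/2 :: real"]])
      (use small pos in auto)
  then have summ: "summable (\<lambda>k. norm1 (B k))" using summable_Suc_iff[of "\<lambda>k. norm1 (B k)"] by blast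
  have bound: "(\<Sum>k<n. f k) \<le> (\<Sum>k. norm1 (B k))" if "\<And>k. f k \<le> norm1 (B k)" for f n
    using sum_mono[of "{..<n}" f "\<lambda>k. norm1 (B k)"] sum_le_suminf[OF summ, of "{..<n}"] that pos by force
  define cc dd where "cc = Abs_ell2 (\<lambda>(k, g). coord (c k) g)" and "dd = Abs_ell2 (\<lambda>(k, g). coord (d k) g)"
  have cc: "coord cc (k, g) = coord (c k) g" and dd: "coord dd (k, g) = coord (d k) g" for k g
    unfolding cc_def dd_def
    by (simp_all add: coord_Abs_l2 ell2_direct_sum[OF bound[OF c]] ell2_direct_sum[OF bound[OF d]])
  have "eip (mltr g cc) dd = z g" for g
  proof -
    \<comment> \<open>The inner product over pairs is summed one copy at a time: copy
      \<open>k\<close> contributes the coefficient \<open>B k g\<close>.\<close>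
    have "((\<lambda>j. coord (mltr g cc) j * cnj (coord dd j)) has_sum eip (mltr g cc) dd) (Sigma UNIV (\<lambda>_. UNIV))"
      using has_sum_infsum[OF l2_prod_summable[OF coord coord]] by (simp add: eip_def l2_inner_def)
    moreover have "((\<lambda>x. coord (mltr g cc) (k, x) * cnj (coord dd (k, x))) has_sum B k g) UNIV" for k
      using has_sum_infsum[OF l2_prod_summable[OF coord[of "ltr g (c k)"] coord[of "d k"]]]
        cd[of g k] by (simp add: eip_def l2_inner_def cc dd)
    ultimately have "((\<lambda>k. B k g) has_sum eip (mltr g cc) dd) UNIV"
      by (rule has_sum_SigmaD)
    then have "(\<lambda>k. B k g) sums eip (mltr g cc) dd" by (rule has_sum_imp_sums)
    then show ?thesis using sums sums_unique2 by blast
  qed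
  then show ?thesis by blast
qed

section \<open>Finite linear combinations and products of Hilbert spaces\<close>

context chilbert
begin

text \<open>Stated for an indexed family with explicit new coefficients, so that one and the same
  choice serves two families at once, as both components of an orbit relation require.\<close>

lemma sum_union_extend:
  assumes "finite F" "finite G"
  shows "(\<Sum>g\<in>F. sc (a g) (v g)) + (\<Sum>g\<in>G. sc (b g) (v g))
    = (\<Sum>g\<in>F \<union> G. sc ((if g \<in> F then a g else 0) + (if g \<in> G then b g else 0)) (v g))"
proof -
  have "(\<Sum>g\<in>F. sc (a g) (v g)) = (\<Sum>g\<in>F \<union> G. sc (if g \<in> F then a g else 0) (v g))"
    using assms by (intro sum.mono_neutral_cong_left) auto
  moreover have "(\<Sum>g\<in>G. sc (b g) (v g)) = (\<Sum>g\<in>F \<union> G. sc (if g \<in> G then b g else 0) (v g))"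
    using assms by (intro sum.mono_neutral_cong_left) auto
  ultimately show ?thesis by (simp add: sc_add_left sum.distrib)
qed

lemma subsp_hspan: "subsp (hspan sc S)"
  unfolding subsp_def
proof (intro conjI ballI allI)
  show "0 \<in> hspan sc S" unfolding hspan_def by (auto intro!: exI[of _ "{}"])
  fix x assume "x \<in> hspan sc S"
  then obtain F a where F: "finite F" "F \<subseteq> S" "x = (\<Sum>v\<in>F. sc (a v) v)"
    unfolding hspan_def by blast
  show "sc c x \<in> hspan sc S" for c
    unfolding hspan_def using F by (auto simp: sc_sum_right intro!: exI[of _ F] exI[of _ "\<lambda>v. c * a v"])
  fix y assume "y \<in> hspan sc S"
  then obtain G b where G: "finite G" "G \<subseteq> S" "y = (\<Sum>v\<in>G. sc (b v) v)"
    unfolding hspan_def by blast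
  show "x + y \<in> hspan sc S"
    unfolding hspan_def
    using F G sum_union_extend[OF F(1) G(1), of a "\<lambda>v. v" b]
    by (intro CollectI exI[of _ "F \<union> G"] exI[of _ "\<lambda>v. (if v \<in> F then a v else 0) + (if v \<in> G then b v else 0)"]) auto
qed

lemma hspan_superset: "v \<in> S \<Longrightarrow> v \<in> hspan sc S"
  unfolding hspan_def by (auto intro!: exI[of _ "{v}"] exI[of _ "\<lambda>_. 1"])

lemma hspan_orthogonal_iff: "(\<forall>x\<in>hspan sc S. ip x w = 0) \<longleftrightarrow> (\<forall>v\<in>S. ip v w = 0)"
proof
  show "\<forall>v\<in>S. ip v w = 0 \<Longrightarrow> \<forall>x\<in>hspan sc S. ip x w = 0"
    unfolding hspan_def by (auto simp: ip_sum_left subset_eq intro!: sum.neutral)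
qed (use hspan_superset in blast)

end

context chilbert_pair
begin

text \<open>The graph of the analysis map lives in this orthogonal direct sum.\<close>

lemma complex_hilbert_space_prod:
  "complex_hilbert_space (\<lambda>a z. (sc a (fst z), sc' a (snd z)))
     (\<lambda>z w. ip (fst z) (fst w) + ip' (snd z) (snd w))"
  (is "complex_hilbert_space ?sc ?ip")
proof -
  have nrm: "hnorm ?ip z = sqrt ((A.nrm (fst z))\<^sup>2 + (B.nrm (snd z))\<^sup>2)" for z
    by (simp add: hnorm_def A.ip_ge_zero B.ip_ge_zero)
  have le: "A.nrm (fst z) \<le> hnorm ?ip z" "B.nrm (snd z) \<le> hnorm ?ip z" for z
    unfolding nrm by (rule real_le_rsqrt; simp)+
  show ?thesis
    unfolding complex_hilbert_space_def
  proof (intro conjI allI impI)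
    show "?ip y x = cnj (?ip x y)" for x y
      using A.ip_commute[of "fst y" "fst x"] B.ip_commute[of "snd y" "snd x"] by simp
    show "0 \<le> Re (?ip x x)" for x by (simp add: A.ip_ge_zero B.ip_ge_zero)
    show "x = 0" if "?ip x x = 0" for x
    proof -
      have "Re (ip (fst x) (fst x)) + Re (ip' (snd x) (snd x)) = 0"
        using arg_cong[OF that, of Re] by simp
      then have "Re (ip (fst x) (fst x)) = 0" "Re (ip' (snd x) (snd x)) = 0"
        using A.ip_ge_zero[of "fst x"] B.ip_ge_zero[of "snd x"] by linarith+
      then have "A.nrm (fst x) = 0" "B.nrm (snd x) = 0" by (simp_all only: hnorm_def real_sqrt_zero)
      then show ?thesis by (simp add: prod_eq_iff)
    qed
    fix X :: "nat \<Rightarrow> 'a \<times> 'b"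
    assume X: "\<forall>e>0. \<exists>N. \<forall>m\<ge>N. \<forall>n\<ge>N. hnorm ?ip (X m - X n) < e"
    have "\<exists>L. A.tends (\<lambda>n. fst (X n)) L"
    proof (rule A.complete)
      fix e :: real assume "e > 0"
      then obtain N where "\<And>m n. m \<ge> N \<Longrightarrow> n \<ge> N \<Longrightarrow> hnorm ?ip (X m - X n) < e" using X by blast
      then have "A.nrm (fst (X m) - fst (X n)) < e" if "m \<ge> N" "n \<ge> N" for m n
        using le_less_trans[OF le(1)[of "X m - X n"]] that by simp
      then show "\<exists>N. \<forall>m\<ge>N. \<forall>n\<ge>N. A.nrm (fst (X m) - fst (X n)) < e" by blast
    qed
    then obtain L where L: "A.tends (\<lambda>n. fst (X n)) L" by blast
    have "\<exists>M. B.tends (\<lambda>n. snd (X n)) M"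
    proof (rule B.complete)
      fix e :: real assume "e > 0"
      then obtain N where "\<And>m n. m \<ge> N \<Longrightarrow> n \<ge> N \<Longrightarrow> hnorm ?ip (X m - X n) < e" using X by blast
      then have "B.nrm (snd (X m) - snd (X n)) < e" if "m \<ge> N" "n \<ge> N" for m n
        using le_less_trans[OF le(2)[of "X m - X n"]] that by simp
      then show "\<exists>N. \<forall>m\<ge>N. \<forall>n\<ge>N. B.nrm (snd (X m) - snd (X n)) < e" by blast
    qed
    then obtain M where M: "B.tends (\<lambda>n. snd (X n)) M" by blast
    have "(\<lambda>n. sqrt ((A.nrm (fst (X n) - L))\<^sup>2 + (B.nrm (snd (X n) - M))\<^sup>2)) \<longlonglongrightarrow> sqrt (0\<^sup>2 + 0\<^sup>2)"
      by (intro tendsto_intros L M)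
    then have "(\<lambda>n. hnorm ?ip (X n - (L, M))) \<longlonglongrightarrow> 0" by (simp add: nrm)
    then show "\<exists>L. (\<lambda>n. hnorm ?ip (X n - L)) \<longlonglongrightarrow> 0" by blast
  qed (simp_all add: A.sc_add_right B.sc_add_right A.sc_add_left B.sc_add_left A.ip_add_left
      B.ip_add_left distrib_left)
qed

end

section \<open>Cyclic representations\<close>

locale cyclic_rep = chilbert sc ip
  for sc :: "complex \<Rightarrow> 'h::ab_group_add \<Rightarrow> 'h" and ip :: "'h \<Rightarrow> 'h \<Rightarrow> complex" +
  fixes U :: "'g::group_add \<Rightarrow> 'h \<Rightarrow> 'h" and psi :: 'h
  assumes rep: "unitary_rep sc ip U"
begin

lemma U_add: "U g (x + y) = U g x + U g y"
  and U_sc: "U g (sc a x) = sc a (U g x)"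
  and U_ip: "ip (U g x) (U g y) = ip x y"
  and U_zero: "U 0 x = x"
  and U_plus: "U (g + h) x = U g (U h x)"
  using rep unfolding unitary_rep_def by simp_all

lemma U_adjoint: "ip (U g x) y = ip x (U (- g) y)"
  using U_ip[of "- g" "U g x" y] by (simp add: U_zero flip: U_plus)

lemma bop_U: "bop sc ip sc ip 1 (U g)"
  by (rule bopI) (simp_all add: U_add U_sc U_ip hnorm_def)

lemma U_sum: "U g (\<Sum>k\<in>F. sc (a k) (v k)) = (\<Sum>k\<in>F. sc (a k) (U g (v k)))"
  by (simp add: bop_sum[OF bop_U] U_sc)

text \<open>A relation instead of a map, because translates of \<open>e\<close> may be linearly
  dependent. That the first combination determines the second is a consequence of the norm bound
  proved below.\<close>

definition orbit_relation :: "(nat \<times> 'g) ell2 \<Rightarrow> ((nat \<times> 'g) ell2 \<times> 'h) set" where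
  "orbit_relation e =
     {(\<Sum>g\<in>F. esc (a g) (mltr g e), \<Sum>g\<in>F. sc (a g) (U g psi)) | F a. finite F}"

lemma orbit_relationI:
  "finite F \<Longrightarrow> (\<Sum>g\<in>F. esc (a g) (mltr g e), \<Sum>g\<in>F. sc (a g) (U g psi)) \<in> orbit_relation e"
  unfolding orbit_relation_def by blast

lemma orbit_relationE:
  assumes "(p, q) \<in> orbit_relation e"
  obtains F a where "finite F" "p = (\<Sum>g\<in>F. esc (a g) (mltr g e))" "q = (\<Sum>g\<in>F. sc (a g) (U g psi))"
  using assms unfolding orbit_relation_def by blast

lemma orbit_relation_linear:
  "chilbert_pair.linear_relation esc sc (orbit_relation e)"
proof -
  interpret KH: chilbert_pair "esc :: complex \<Rightarrow> (nat \<times> 'g) ell2 \<Rightarrow> _" eip sc ip ..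
  show ?thesis
    unfolding KH.linear_relation_def
  proof (intro conjI allI impI)
    show "(0, 0) \<in> orbit_relation e" using orbit_relationI[of "{}"] by simp
    fix p q assume "(p, q) \<in> orbit_relation e"
    then obtain F a where F: "finite F" "p = (\<Sum>g\<in>F. esc (a g) (mltr g e))"
      "q = (\<Sum>g\<in>F. sc (a g) (U g psi))" by (rule orbit_relationE)
    show "(esc b p, sc b q) \<in> orbit_relation e" for b
      using orbit_relationI[OF F(1), of "\<lambda>g. b * a g"] by (simp add: F E.sc_sum_right sc_sum_right)
    fix p' q' assume "(p', q') \<in> orbit_relation e"
    then obtain F' a' where F': "finite F'" "p' = (\<Sum>g\<in>F'. esc (a' g) (mltr g e))"
      "q' = (\<Sum>g\<in>F'. sc (a' g) (U g psi))" by (rule orbit_relationE)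
    show "(p + p', q + q') \<in> orbit_relation e"
      unfolding F(2,3) F'(2,3) sum_union_extend[OF F(1) F'(1)] E.sum_union_extend[OF F(1) F'(1)]
      using F(1) F'(1) by (intro orbit_relationI) simp
  qed
qed

lemma orbit_relation_translate:
  assumes "(p, q) \<in> orbit_relation e"
  shows "(mltr k p, U k q) \<in> orbit_relation e"
proof -
  obtain F a where F: "finite F" "p = (\<Sum>g\<in>F. esc (a g) (mltr g e))"
    "q = (\<Sum>g\<in>F. sc (a g) (U g psi))" by (rule orbit_relationE[OF assms])
  have inj: "inj_on (\<lambda>g. k + g) F" by (simp add: inj_on_def)
  have "mltr k p = (\<Sum>g\<in>(\<lambda>g. k + g) ` F. esc (a (- k + g)) (mltr g e))"
    by (simp add: F(2) sum.reindex[OF inj] bop_sum[OF bop_mltr] bop_sc[OF bop_mltr] mltr_mltr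
        flip: add.assoc)
  moreover have "U k q = (\<Sum>g\<in>(\<lambda>g. k + g) ` F. sc (a (- k + g)) (U g psi))"
    by (simp add: F(3) sum.reindex[OF inj] U_sum U_plus flip: add.assoc)
  ultimately show ?thesis using orbit_relationI[of "(\<lambda>g. k + g) ` F"] F(1) by simp
qed

text \<open>Since the left-hand side is a squared norm, it is dominated by the translates of the single
  vector \<open>(c + d) / 2\<close>, by polarisation.\<close>

lemma orbit_relation_bound:
  assumes cd: "\<And>g. eip (mltr g c) d = ip (U g psi) psi"
    and pq: "(p, q) \<in> orbit_relation (esc (1/2) (c + d))"
  shows "nrm q \<le> 1 * hnorm eip p"
proof -
  obtain F a where F: "finite F" "p = (\<Sum>g\<in>F. esc (a g) (mltr g (esc (1/2) (c + d))))"
    "q = (\<Sum>g\<in>F. sc (a g) (U g psi))" by (rule orbit_relationE[OF pq])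
  define x y where "x = (\<Sum>g\<in>F. esc (a g) (mltr g c))" and "y = (\<Sum>g\<in>F. esc (a g) (mltr g d))"
  have p: "p = esc (1/2) (x + y)"
    by (simp add: F(2) x_def y_def bop_add[OF bop_mltr] bop_sc[OF bop_mltr] E.sc_add_right
        E.sc_sum_right sum.distrib mult.commute)
  have UU: "ip (U g psi) (U h psi) = eip (mltr g c) (mltr h d)" for g h
  proof -
    have "eip (mltr g c) (mltr h d) = eip (mltr (- h) (mltr g c)) d"
      by (simp add: mltr_adjoint[of "- h"])
    also have "\<dots> = ip (U (- h) (U g psi)) psi" by (simp add: mltr_mltr cd U_plus)
    finally show ?thesis by (simp add: U_adjoint[of "- h"])
  qed
  have "ip q q = eip x y"
    by (simp add: F(3) x_def y_def ip_sum_left ip_sum_right E.ip_sum_left E.ip_sum_right UU)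
  then have "(nrm q)\<^sup>2 = Re (eip x y)" by (simp add: nrm_power2)
  also have "\<dots> = ((hnorm eip (x + y))\<^sup>2 - (hnorm eip (x - y))\<^sup>2) / 4"
    by (simp add: E.nrm_add_power2 E.nrm_diff_power2)
  also have "\<dots> \<le> (hnorm eip (x + y))\<^sup>2 / 4" by simp
  also have "\<dots> = (hnorm eip p)\<^sup>2" by (simp add: p power_divide)
  finally have "nrm q \<le> hnorm eip p" by (rule power2_le_imp_le) (rule hnorm_eip_nonneg)
  then show ?thesis by simp
qed

section \<open>The domain and kernel of the analysis map\<close>

definition square_integrable :: "'h \<Rightarrow> bool" where
  "square_integrable v \<longleftrightarrow> (\<lambda>g. ip v (U g psi)) \<in> l2"

text \<open>\<open>Z\<close> is the adjoint of the contraction taking translates of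
  \<open>?e\<close> to the orbit of \<open>psi\<close>. The coefficients of
  \<open>Z' (edelta (k, h))\<close> are conjugates of distinct coordinates of the single vector
  \<open>Z psi\<close>, hence square summable. A vector \<open>w\<close> orthogonal to all of these
  has \<open>Z w = 0\<close>, so it is orthogonal to the orbit; its own coefficients are then zero,
  which makes it square integrable and orthogonal to itself.\<close>

lemma square_integrable_dense:
  assumes cd: "\<And>g. eip (mltr g c) d = ip (U g psi) psi"
    and w: "\<And>v. square_integrable v \<Longrightarrow> ip v w = 0"
  shows "w = 0"
proof -
  interpret KH: chilbert_pair "esc :: complex \<Rightarrow> (nat \<times> 'g) ell2 \<Rightarrow> _" eip sc ip ..
  interpret HK: chilbert_pair sc ip "esc :: complex \<Rightarrow> (nat \<times> 'g) ell2 \<Rightarrow> _" eip ..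
  let ?e = "esc (1/2) (c + d)"
  obtain Z where Z: "bop sc ip esc eip 1 Z" "KH.dual_of (orbit_relation ?e) Z"
    using KH.ex_dual[OF orbit_relation_linear zero_le_one, of ?e] orbit_relation_bound[OF cd] by blast
  have ZU: "Z (U g v) = mltr g (Z v)" for g v
    by (rule KH.dual_commute[OF Z(2) mltr_adjoint U_adjoint orbit_relation_translate
          orbit_relation_translate orbit_relation_linear])
  obtain Z' where Z': "\<And>x y. eip (Z x) y = ip x (Z' y)"
    using HK.ex_adjoint[OF Z(1)] by blast
  have "square_integrable (Z' (edelta (k, h)))" for k h
  proof -
    have "ip (Z' (edelta (k, h))) (U g psi) = cnj (coord (Z psi) (k, - g + h))" for g
    proof -
      have "ip (Z' (edelta (k, h))) (U g psi) = cnj (ip (U g psi) (Z' (edelta (k, h))))"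
        by (rule ip_commute)
      then show ?thesis by (simp add: ZU eip_edelta flip: Z')
    qed
    moreover have "(\<lambda>g. cnj (coord (Z psi) (k, - g + h))) \<in> l2"
    proof (rule l2I)
      fix F :: "'g set" assume F: "finite F"
      have inj: "inj_on (\<lambda>g. (k, - g + h)) F" by (simp add: inj_on_def)
      have "(\<Sum>g\<in>F. (cmod (cnj (coord (Z psi) (k, - g + h))))\<^sup>2)
          = (\<Sum>j\<in>(\<lambda>g. (k, - g + h)) ` F. (cmod (coord (Z psi) j))\<^sup>2)"
        by (simp add: sum.reindex[OF inj])
      also have "\<dots> \<le> (hnorm eip (Z psi))\<^sup>2" using F by (intro sum_le_enrm) simp
      finally show "(\<Sum>g\<in>F. (cmod (cnj (coord (Z psi) (k, - g + h))))\<^sup>2) \<le> (hnorm eip (Z psi))\<^sup>2" .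
    qed
    ultimately show ?thesis by (simp add: square_integrable_def)
  qed
  then have "ip (Z' (edelta j)) w = 0" for j using w by (cases j) simp
  then have "coord (Z w) j = 0" for j
    using ip_commute[of w "Z' (edelta j)"] Z'[of w "edelta j"] by (simp add: eip_edelta)
  then have "Z w = 0" by (intro ell2_eqI) simp
  have "ip w (U g psi) = 0" for g
  proof -
    have "(mltr g ?e, U g psi) \<in> orbit_relation ?e"
      using orbit_relationI[of "{g}" "\<lambda>_. 1" ?e] by simp
    then have "ip (U g psi) w = eip (mltr g ?e) (Z w)"
      using KH.dual_of_ip[OF Z(2)] by simp
    then show ?thesis using ip_commute[of w "U g psi"] \<open>Z w = 0\<close> by simp
  qed
  then have "square_integrable w" by (simp add: square_integrable_def l2_zero)
  then show ?thesis using w ip_self_zero by blast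
qed

text \<open>The analysis map \<open>v \<mapsto> (ip v (U g psi))\<^sub>g\<close> is in general only a closed, densely defined operator
  \<open>C\<close>. Projecting \<open>(x, 0)\<close> to its graph replaces it by the bounded operator \<open>C (1 + C\<^sup>* C)\<^sup>-\<^sup>1\<close> with
  the same kernel.\<close>

lemma bounded_analysis:
  assumes dense: "\<And>w. (\<And>v. square_integrable v \<Longrightarrow> ip v w = 0) \<Longrightarrow> w = 0"
  shows "\<exists>T. bop sc ip esc eip 1 T \<and> (\<forall>g x. T (U g x) = ltr g (T x)) \<and>
    (\<forall>w. (\<forall>g. ip (U g psi) w = 0) \<longrightarrow> T w = 0) \<and>
    (\<forall>x. T x = 0 \<longrightarrow> (\<forall>w. (\<forall>g. ip (U g psi) w = 0) \<longrightarrow> ip x w = 0) \<longrightarrow> x = 0)"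
proof -
  interpret HE: chilbert_pair sc ip "esc :: complex \<Rightarrow> 'g ell2 \<Rightarrow> _" eip ..
  define psc where "psc a z = (sc a (fst z), esc a (snd z))" for a and z :: "'h \<times> 'g ell2"
  define pip where "pip z w = ip (fst z) (fst w) + eip (snd z) (snd w)" for z w :: "'h \<times> 'g ell2"
  have "psc = (\<lambda>a z. (sc a (fst z), esc a (snd z)))"
    and "pip = (\<lambda>z w. ip (fst z) (fst w) + eip (snd z) (snd w))"
    by (simp_all add: fun_eq_iff psc_def pip_def)
  then interpret PH: chilbert_pair psc pip sc ip
    by unfold_locales (simp only: HE.complex_hilbert_space_prod)
  have pnrm: "(hnorm pip z)\<^sup>2 = (nrm (fst z))\<^sup>2 + (hnorm eip (snd z))\<^sup>2" for z
    by (simp add: PH.A.nrm_power2 nrm_power2 E.nrm_power2) (simp add: pip_def)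
  have fst_le: "nrm (fst z) \<le> hnorm pip z" and snd_le: "hnorm eip (snd z) \<le> hnorm pip z" for z
    by (rule power2_le_imp_le; simp add: pnrm)+
  define C where "C v = Abs_ell2 (\<lambda>g. ip v (U g psi))" for v
  have C: "coord (C v) g = ip v (U g psi)" if "square_integrable v" for v g
    using that by (simp add: C_def square_integrable_def coord_Abs_l2)
  \<comment> \<open>Pairing \<open>(v, C v)\<close> with \<open>Z x\<close> must give the inner
    product of \<open>v\<close> with \<open>x\<close>, which is the pairing of
    \<open>(v, C v)\<close> with \<open>(x, 0)\<close>. Hence the dual \<open>Z\<close> sends
    \<open>x\<close> to the projection of \<open>(x, 0)\<close> to the closed graph, and
    \<open>T\<close> is its second component.\<close>
  define G where "G = {((v, y), v) | v y. \<forall>g. coord y g = ip v (U g psi)}"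
  have GI: "((v, y), v) \<in> G" if "\<And>g. coord y g = ip v (U g psi)" for v y
    using that by (simp add: G_def)
  have GD: "q = fst p \<and> coord (snd p) g = ip (fst p) (U g psi)" if "(p, q) \<in> G" for p q g
    using that by (auto simp: G_def)
  have lin: "PH.linear_relation G"
    unfolding PH.linear_relation_def by (auto simp: G_def psc_def zero_prod_def ip_add_left)
  have bnd: "nrm q \<le> 1 * hnorm pip p" if "(p, q) \<in> G" for p q
    using GD[OF that] fst_le[of p] by simp
  obtain Z where Z: "bop sc ip psc pip 1 Z" "PH.dual_of G Z"
    using PH.ex_dual[OF lin zero_le_one bnd] by blast
  define T where "T x = snd (Z x)" for x
  \<comment> \<open>Closedness of the graph: both components converge in norm, so the coordinate
    equations pass to the limit.\<close>
  have ZT: "coord (T x) g = ip (fst (Z x)) (U g psi)" for x g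
  proof -
    obtain s where s: "\<And>n. s n \<in> fst ` G" "PH.A.tends s (Z x)"
      using PH.A.mem_hclosure_seq[OF PH.dual_of_closure[OF Z(2)]] by blast
    have sn: "coord (snd (s n)) g = ip (fst (s n)) (U g psi)" for n
      using s(1)[of n] GD by force
    have f: "tends (\<lambda>n. fst (s n)) (fst (Z x))"
      by (rule tendsI[OF _ s(2)]) (metis fst_diff fst_le)
    have t: "E.tends (\<lambda>n. snd (s n)) (T x)"
      by (rule E.tendsI[OF _ s(2)]) (metis T_def snd_diff snd_le)
    have "(\<lambda>n. coord (snd (s n)) g) \<longlonglongrightarrow> coord (T x) g"
      using E.tends_ip_left[OF t, of "edelta g"] by (simp add: eip_edelta)
    moreover have "(\<lambda>n. coord (snd (s n)) g) \<longlonglongrightarrow> ip (fst (Z x)) (U g psi)"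
      using tends_ip_left[OF f] by (simp add: sn)
    ultimately show ?thesis by (rule LIMSEQ_unique)
  qed
  have dual: "ip v (fst (Z x)) + eip (C v) (T x) = ip v x" if "square_integrable v" for v x
    using PH.dual_of_ip[OF Z(2) GI[OF C[OF that]], of x] by (simp add: pip_def T_def)
  have bopT: "bop sc ip esc eip 1 T"
  proof (rule bopI)
    show "hnorm eip (T x) \<le> 1 * nrm x" for x
      using order_trans[OF snd_le bop_bound[OF Z(1), of x]] by (simp add: T_def)
  qed (simp_all add: T_def bop_add[OF Z(1)] bop_sc[OF Z(1)] psc_def)
  have TU: "T (U g x) = ltr g (T x)" for g x
  proof -
    define u where "u g z = (U g (fst z), ltr g (snd z))" for g and z :: "'h \<times> 'g ell2"
    have "Z (U g x) = u g (Z x)"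
    proof (rule PH.dual_commute[OF Z(2) _ U_adjoint _ _ lin])
      show "pip (u g z) z' = pip z (u (- g) z')" for z z'
        by (simp add: pip_def u_def U_adjoint ltr_adjoint)
      have inv: "(u g p, U g q) \<in> G" if pq: "(p, q) \<in> G" for p q g
      proof -
        have "coord (ltr g (snd p)) h = ip (U g (fst p)) (U h psi)" for h
          using GD[OF pq] by (simp add: U_adjoint flip: U_plus)
        then show ?thesis using GI GD[OF pq] by (simp add: u_def)
      qed
      show "(u g p, U g q) \<in> G" "(u (- g) p, U (- g) q) \<in> G" if "(p, q) \<in> G" for p q
        using inv[OF that] by blast+
    qed
    then show ?thesis by (simp add: T_def u_def)
  qed
  \<comment> \<open>A vector orthogonal to the orbit has zero coefficients, so \<open>(w, 0)\<close>
    is already in the graph and is its own projection.\<close>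
  have T0: "T w = 0" if w: "\<forall>g. ip (U g psi) w = 0" for w
  proof -
    have w': "ip w (U g psi) = 0" for g using w ip_commute[of w "U g psi"] by simp
    have "Z w = (w, 0)"
    proof (rule PH.dual_of_eqI[OF Z(2)])
      have "(w, 0) \<in> fst ` G" using GI[of 0 w] w' by force
      then show "(w, 0) \<in> hclosure pip (fst ` G)" using PH.A.hclosure_superset by blast
      show "pip p (w, 0) = ip q w" if "(p, q) \<in> G" for p q
        using GD[OF that] by (simp add: pip_def)
    qed
    then show ?thesis by (simp add: T_def)
  qed
  \<comment> \<open>If the second component vanishes, density of the domain gives
    \<open>Z x = (x, 0)\<close>. Then \<open>(x, 0)\<close> is in the graph, so \<open>x\<close> is
    orthogonal to the orbit; being orthogonal to all such vectors, it is zero.\<close>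
  have inj: "x = 0" if Tx: "T x = 0" and x: "\<forall>w. (\<forall>g. ip (U g psi) w = 0) \<longrightarrow> ip x w = 0" for x
  proof -
    have "ip v (x - fst (Z x)) = 0" if "square_integrable v" for v
      using dual[OF that, of x] Tx by (simp add: ip_diff_right)
    then have "x - fst (Z x) = 0" by (rule dense)
    then have Zx: "fst (Z x) = x" by simp
    have "ip (U g psi) x = 0" for g
      using ZT[of x g] Tx ip_commute[of "U g psi" x] by (simp add: Zx)
    then have "ip x x = 0" using x by blast
    then show ?thesis by (rule ip_self_zero)
  qed
  show ?thesis using bopT TU T0 inj by blast
qed

text \<open>\<open>Y\<close> is the adjoint of the partial isometry of \<open>T\<close>, so
  \<open>Y'\<close> is that partial isometry and its coordinates are the frame coefficients. The
  Parseval identity therefore amounts to \<open>Y'\<close> being isometric on the closure of the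
  range of \<open>P\<close>, together with the cyclic space lying in that closure.\<close>

lemma parseval_of_dense:
  assumes dense: "\<And>w. (\<And>v. square_integrable v \<Longrightarrow> ip v w = 0) \<Longrightarrow> w = 0"
  shows "\<exists>phi. parseval_frame_for ip (\<lambda>g. U g phi) (hclosure ip (hspan sc (range (\<lambda>g. U g psi))))"
proof -
  interpret HE: chilbert_pair sc ip "esc :: complex \<Rightarrow> 'g ell2 \<Rightarrow> _" eip ..
  interpret EH: chilbert_pair "esc :: complex \<Rightarrow> 'g ell2 \<Rightarrow> _" eip sc ip ..
  let ?S = "hspan sc (range (\<lambda>g. U g psi))"
  have orth: "(\<forall>s\<in>?S. ip s w = 0) \<longleftrightarrow> (\<forall>g. ip (U g psi) w = 0)" for w
    unfolding hspan_orthogonal_iff by blast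
  obtain T where T: "bop sc ip esc eip 1 T" "\<And>g x. T (U g x) = ltr g (T x)"
    "\<And>w. \<forall>g. ip (U g psi) w = 0 \<Longrightarrow> T w = 0"
    "\<And>x. T x = 0 \<Longrightarrow> \<forall>w. (\<forall>g. ip (U g psi) w = 0) \<longrightarrow> ip x w = 0 \<Longrightarrow> x = 0"
    using bounded_analysis[OF dense] by blast
  obtain P Y where pol: "HE.polar T P Y" using HE.ex_polar[OF T(1)] by blast
  obtain D where P: "pos_op D P" using HE.polar_pos[OF pol] by blast
  note bopP = pos_op_bop[OF P]
  have kernel: "P w = 0 \<longleftrightarrow> T w = 0" for w
    using HE.polar_nrm[OF pol, of w] by (metis E.nrm_zero_iff nrm_zero_iff)
  have YL: "Y (ltr g y) = U g (Y y)" for g y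
    by (rule HE.polar_commute_dual[OF pol T(1) bop_U bop_U[of "- g"]])
      (simp_all add: U_adjoint ltr_adjoint T(2))
  define phi where "phi = Y (edelta 0)"
  have Uphi: "U g phi = Y (edelta g)" for g
    by (simp add: phi_def ltr_edelta flip: YL)
  obtain Y' where Y': "bop sc ip esc eip 1 Y'" "\<And>x y. ip (Y x) y = eip x (Y' y)"
    using EH.ex_adjoint[OF HE.polar_bop[OF pol]] by blast
  have coordY': "coord (Y' v) g = ip v (U g phi)" for v g
  proof -
    have "coord (Y' v) g = cnj (eip (edelta g) (Y' v))"
      unfolding eip_edelta[symmetric] by (rule E.ip_commute)
    also have "\<dots> = ip v (U g phi)" unfolding Uphi Y'(2)[symmetric] by (rule ip_commute[symmetric])
    finally show ?thesis .
  qed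
  have "U g phi \<in> hclosure ip ?S" for g
  proof (rule orthogonal_complement_complement[OF subsp_hspan])
    fix w assume "\<And>s. s \<in> ?S \<Longrightarrow> ip s w = 0"
    then have "T w = 0" using orth[of w] T(3) by blast
    then have "P w = 0" by (simp add: kernel)
    have "Y (edelta g) \<in> hclosure ip (fst ` range (\<lambda>x. (P x, T x)))"
      by (rule HE.dual_of_closure[OF HE.polar_dual[OF pol]])
    then have "ip (Y (edelta g)) w = 0"
      by (rule hclosure_orthogonal) (auto simp: pos_op_herm[OF P] \<open>P w = 0\<close>)
    then show "ip (U g phi) w = 0" by (simp add: Uphi)
  qed
  moreover have "((\<lambda>g. (cmod (ip v (U g phi)))\<^sup>2) has_sum (nrm v)\<^sup>2) UNIV" if v: "v \<in> hclosure ip ?S" for v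
  proof -
    have subsp_P: "subsp (range P)"
      unfolding subsp_def
      by (auto intro: range_eqI[of _ P 0] simp: bop_zero[OF bopP]
          simp flip: bop_add[OF bopP] bop_sc[OF bopP])
    have "v \<in> hclosure ip (range P)"
    proof (rule orthogonal_complement_complement[OF subsp_P])
      fix w assume w: "\<And>s. s \<in> range P \<Longrightarrow> ip s w = 0"
      have "ip x (P w) = 0" for x using w[of "P x"] by (simp add: pos_op_herm[OF P])
      then have "T w = 0" using kernel ip_nondegenerate by blast
      \<comment> \<open>\<open>T\<close> kills both \<open>w\<close> and its part orthogonal to the
        orbit, hence also the projection \<open>w'\<close> to the cyclic space. There
        \<open>T\<close> is injective, so \<open>w'\<close> is zero and \<open>w\<close> is
        orthogonal to \<open>v\<close>.\<close>
      obtain w' where w': "w' \<in> hclosure ip ?S" "\<And>s. s \<in> ?S \<Longrightarrow> ip s w = ip s w'"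
        using ex_projection[OF subsp_hspan] by blast
      have "\<forall>s\<in>?S. ip s (w - w') = 0" using w'(2) by (simp add: ip_diff_right)
      then have "T (w - w') = 0" using T(3) orth by blast
      then have "T w' = 0" by (simp add: bop_diff[OF T(1)] \<open>T w = 0\<close>)
      moreover have "\<forall>z. (\<forall>g. ip (U g psi) z = 0) \<longrightarrow> ip w' z = 0"
        using hclosure_orthogonal[OF w'(1)] orth by blast
      ultimately have "w' = 0" by (rule T(4))
      then show "ip v w = 0" using hclosure_orthogonal[OF v] w'(2) by simp
    qed
    then obtain s where s: "\<And>n. s n \<in> range P" "tends s v" by (rule mem_hclosure_seq) blast
    have "hnorm eip (Y' (s n)) = nrm (s n)" for n
    proof -
      obtain x where x: "s n = P x" using s(1)[of n] by blast
      \<comment> \<open>On the range of \<open>P\<close> the map \<open>Y'\<close> acts by sending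
        \<open>P x\<close> to \<open>T x\<close>, and these have equal norms.\<close>
      have "coord (Y' (P x)) g = coord (T x) g" for g
        using HE.polar_ip[OF pol, of x "edelta g"] by (simp add: coordY' Uphi eip_edelta)
      then have "Y' (P x) = T x" by (rule ell2_eqI)
      then show ?thesis using HE.polar_nrm[OF pol, of x] by (simp add: x)
    qed
    moreover have "(\<lambda>n. hnorm eip (Y' (s n))) \<longlonglongrightarrow> hnorm eip (Y' v)"
      by (intro E.tends_nrm HE.bop_tends[OF Y'(1)] s)
    moreover have "(\<lambda>n. nrm (s n)) \<longlonglongrightarrow> nrm v" by (intro tends_nrm s)
    ultimately have "hnorm eip (Y' v) = nrm v" using LIMSEQ_unique by auto
    then show ?thesis using enrm_has_sum[of "Y' v"] by (simp add: coordY')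
  qed
  ultimately show ?thesis unfolding parseval_frame_for_def by blast
qed

end

theorem theorem6p1:
  fixes sc :: "complex \<Rightarrow> 'h::ab_group_add \<Rightarrow> 'h"
    and ip :: "'h \<Rightarrow> 'h \<Rightarrow> complex"
    and U :: "'g::{group_add, countable} \<Rightarrow> 'h \<Rightarrow> 'h"
    and psi :: 'h
  assumes "complex_hilbert_space sc ip"
    and "hseparable ip"
    and "unitary_rep sc ip U"
    and "dual_integrable sc ip U"
    and "psi \<noteq> 0"
  shows "\<exists>phi. parseval_frame_for ip (\<lambda>g. U g phi)
                 (hclosure ip (hspan sc (range (\<lambda>g. U g psi))))"
proof -
  interpret cyclic_rep sc ip U psi
    by unfold_locales (fact assms)+
  obtain br :: "'h \<Rightarrow> 'h \<Rightarrow> nat \<Rightarrow> 'g \<Rightarrow> complex"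
    where br: "\<forall>x y. L1_seq (br x y)" "\<forall>x y g. L1_tau_rho_eq (br x y) g (ip x (U g y))"
    using assms(4) unfolding dual_integrable_def by (elim exE conjE) (rule that)
  define A where "A = br psi psi"
  have A: "L1_seq A" "\<And>g. L1_tau_rho_eq A g (ip psi (U g psi))"
    using br by (simp_all add: A_def)
  have fin: "finsupp (A n)" for n using A(1) unfolding L1_seq_def by blast
  \<comment> \<open>The trace condition is used at \<open>- g\<close>: the trace yields the
    coefficient at the inverse, and unitarity turns \<open>ip psi (U (- g) psi)\<close> into
    \<open>ip (U g psi) psi\<close>.\<close>
  have "(\<lambda>n. A n g) \<longlonglongrightarrow> ip (U g psi) psi" for g
    using A(2)[of "- g"] by (simp add: L1_tau_rho_eq_def tau_spanop_rho[OF fin] U_adjoint)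
  then obtain c d :: "(nat \<times> 'g) ell2" where "\<And>g. eip (mltr g c) d = ip (U g psi) psi"
    using L1_coefficients[OF A(1), of "\<lambda>g. ip (U g psi) psi"] by blast
  then show ?thesis using square_integrable_dense by (intro parseval_of_dense) blast
qed

end
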